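(* Let $\{x(s)\}_{s\ge0}$ be an $\mathbb R^d$-valued stochastic process in $L^2$, and let $\mathcal S_T=\int_0^Tx(s)\,ds$ for $T\ge0$. Assume that there exist a neighbourhood $\mathcal O$ of $\mathbf 0$ in $\mathbb R^d$ and functions $c(t)$, $\lambda_s(t)$ ($s\ge1$ real) and $d_T(t)$ ($T\ge0$) defined on $\mathcal O$ such that for all $t\in\mathcal O$ and all $T\ge0$, $$\mathbb E\left(\exp\{i\langle t,\mathcal S_T\rangle\}\right)=c(t)\exp\left\{\int_1^{h}m_s\ln\lambda_s(t)\,ds\right\}+d_T(t),$$ where $h=h(T)$ is a positive integer and $\{m_s\}_{s\in[1,h]}$ (possibly depending on $T$) satisfies $\int_1^hm_s\,ds=T$. Assume moreover: (i) There exist $A_s$ and $\sigma_s$ in $\mathbb R^d$, for $s\in[1,h]$, such that as $t\to\mathbf 0$ (i.e. $t_i\to0$ for $i=1,\dots,d$), $$\lambda_s(t)=\exp\left\{i\langle t,A_s\rangle-\frac{t^{\mathrm T}\sigma_s^2t}{2}+o(t^{\mathrm T}t)\right\}.$$ (ii) The function $c$ is continuous at $\mathbf 0$. (iii) $\|d_T\|_{L^\infty(\mathcal O)}\to0$ as $T\to\infty$. Consider further the following two assumptions: (iv) Every element of the $d\times d$ matrix $\frac1T\int_1^{h}m_s\sigma_s^2\,ds$ has a non-negative limit as $T\to\infty$; denote by $\mu^2$ the $d\times d$ matrix of these limits. (v) Every element of the $d\times d$ matrix $\frac1T\int_1^{h}m_s\sigma_s^2\,ds$ has a non-negative bound (uniform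 in $T$); denote by $\eta^2$ the $d\times d$ matrix of these bounds. Then: (a) Under (i)-(iv), $\left(\mathcal S_T-\int_1^hm_sA_s\,ds\right)/\sqrt T$ converges in distribution to $\mathcal N(\mathbf 0,\mu^2)$ as $T\to\infty$. (b) Under (i)-(iii) and (v), there exist a $d\times d$ matrix $\zeta^2$ and a sequence of times $(T_j)_{j\in\mathbb N}$ with $T_j\to\infty$ such that every element of $\zeta^2$ is bounded by the corresponding element of $\eta^2$ and, with $h_j=h(T_j)$ and with the $m_s$ being those associated with $T_j$, $\left(\mathcal S_{T_j}-\int_1^{h_j}m_sA_s\,ds\right)/\sqrt{T_j}$ converges in distribution to $\mathcal N(\mathbf 0,\zeta^2)$ as $j\to\infty$.
   Context: $\mathbb R^d$ carries the Euclidean inner product $\langle\cdot,\cdot\rangle$. For a vector $z\in\mathbb R^d$, $z^2$ denotes the $d\times d$ matrix $zz^{\mathrm T}$; in particular $\sigma_s^2=\sigma_s\sigma_s^{\mathrm T}$. The symbols $\mu^2,\eta^2,\zeta^2$ simply name $d\times d$ matrices. $\mathcal N(m,\Sigma)$ denotes the (possibly degenerate) Gaussian distribution on $\mathbb R^d$ with mean $m$ and covariance matrix $\Sigma$. The functions $c,\lambda_s,d_T$ are complex-valued, the $m_s$ are real, and all integrals in $s$ are assumed to make sense; $c$, the $\lambda_s$, and the vectors $A_s,\sigma_s$ do not depend on $T$. The logarithm $\ln\lambda_s(t)$ is the branch which, as $t\to\mathbf 0$, equals the exponent $i\langle t,A_s\rangle-\frac12t^{\mathrm T}\sigma_s^2t+o(t^{\mathrm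 T}t)$.
   Formalization: The o(t^T t) in (i) is taken uniform in s over all s occurring in some [1,h(T)], and the integral of |m_s| over [1,h] is assumed to be at most CT for large T (automatic if m_s is non-negative); without either condition the statement is false. *)

theory Defs
  imports "HOL-Probability.Probability"
begin

definition outer_square :: "real ^ 'n \<Rightarrow> real ^ 'n ^ 'n"
  where "outer_square z = (\<chi> i j. z $ i * z $ j)"

definition std_gaussian :: "(real ^ 'n) measure"
  where "std_gaussian = density lborel (\<lambda>z. ennreal (\<Prod>i\<in>UNIV. std_normal_density (z $ i)))"

text \<open>The law of \<open>a + B Z\<close> with \<open>Z\<close> standard normal has mean \<open>a\<close> and covariance \<open>B B\<^sup>T\<close>, and
  depends on \<open>B\<close> only through \<open>B B\<^sup>T\<close>. The matrix \<open>B\<close> may be singular, so degenerate Gaussians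
  are included. A law \<open>N\<close> with \<open>is_gaussian a \<Sigma> N\<close> exists only if \<open>\<Sigma>\<close> is symmetric and positive
  semidefinite.\<close>

definition is_gaussian :: "real ^ 'n \<Rightarrow> real ^ 'n ^ 'n \<Rightarrow> (real ^ 'n) measure \<Rightarrow> bool"
  where "is_gaussian a \<Sigma> N \<longleftrightarrow>
    (\<exists>B :: real ^ 'n ^ 'n. B ** transpose B = \<Sigma> \<and> N = distr std_gaussian borel (\<lambda>z. a + B *v z))"

text \<open>The library's \<open>weak_conv_m\<close> covers only laws on the real line.\<close>

definition converges_in_distribution ::
  "'a measure \<Rightarrow> ('i \<Rightarrow> 'a \<Rightarrow> real ^ 'n) \<Rightarrow> (real ^ 'n) measure \<Rightarrow> 'i filter \<Rightarrow> bool"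
  where "converges_in_distribution M X N F \<longleftrightarrow>
    (\<forall>f :: real ^ 'n \<Rightarrow> real. continuous_on UNIV f \<longrightarrow> bounded (range f) \<longrightarrow>
      ((\<lambda>T. LINT \<omega>|M. f (X T \<omega>)) \<longlongrightarrow> (LINT y|N. f y)) F)"

text \<open>The \<open>L\<^sup>\<infinity>\<close> norm is an essential supremum with respect to Lebesgue measure. It is infinite
  if \<open>\<lambda>t. norm (f t)\<close> is not Lebesgue measurable on \<open>U\<close>.\<close>

definition Linf_norm :: "(real ^ 'n) set \<Rightarrow> (real ^ 'n \<Rightarrow> complex) \<Rightarrow> ennreal"
  where "Linf_norm U f = esssup (lebesgue_on U) (\<lambda>t. ennreal (norm (f t)))"

definition L2_process :: "'a measure \<Rightarrow> (real \<Rightarrow> 'a \<Rightarrow> real ^ 'n) \<Rightarrow> bool"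
  where "L2_process M x \<longleftrightarrow>
    (\<forall>s\<ge>0. x s \<in> borel_measurable M \<and> integrable M (\<lambda>\<omega>. (norm (x s \<omega>))\<^sup>2))"

text \<open>The integral of the process over \<open>[0,T]\<close> is taken path by path.\<close>

definition path_integral :: "(real \<Rightarrow> 'a \<Rightarrow> real ^ 'n) \<Rightarrow> real \<Rightarrow> 'a \<Rightarrow> real ^ 'n"
  where "path_integral x T \<omega> = (LINT s:{0..T}|lebesgue. x s \<omega>)"

definition path_integral_defined :: "'a measure \<Rightarrow> (real \<Rightarrow> 'a \<Rightarrow> real ^ 'n) \<Rightarrow> bool"
  where "path_integral_defined M x \<longleftrightarrow>
    (\<forall>T\<ge>0. (AE \<omega> in M. set_integrable lebesgue {0..T} (\<lambda>s. x s \<omega>)) \<and>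
            path_integral x T \<in> borel_measurable M)"

text \<open>In \<open>h T\<close> and \<open>m T s\<close> the dependence on \<open>T\<close> is explicit.\<close>

definition weighted_integrable ::
  "(real \<Rightarrow> nat) \<Rightarrow> (real \<Rightarrow> real \<Rightarrow> real) \<Rightarrow> real \<Rightarrow> (real \<Rightarrow> 'b :: {banach, second_countable_topology}) \<Rightarrow> bool"
  where "weighted_integrable h m T f \<longleftrightarrow>
    set_integrable lebesgue {1..real (h T)} (\<lambda>s. m T s *\<^sub>R f s)"

definition weighted_integral ::
  "(real \<Rightarrow> nat) \<Rightarrow> (real \<Rightarrow> real \<Rightarrow> real) \<Rightarrow> real \<Rightarrow> (real \<Rightarrow> 'b :: {banach, second_countable_topology}) \<Rightarrow> 'b"
  where "weighted_integral h m T f = (LINT s:{1..real (h T)}|lebesgue. m T s *\<^sub>R f s)"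

definition quadratic_exponent :: "real ^ 'n \<Rightarrow> real ^ 'n \<Rightarrow> real ^ 'n \<Rightarrow> complex"
  where "quadratic_exponent A \<sigma> t =
    \<i> * complex_of_real (t \<bullet> A) - complex_of_real ((t \<bullet> (outer_square \<sigma> *v t)) / 2)"

definition normalised_sum ::
  "(real \<Rightarrow> 'a \<Rightarrow> real ^ 'n) \<Rightarrow> (real \<Rightarrow> nat) \<Rightarrow> (real \<Rightarrow> real \<Rightarrow> real) \<Rightarrow> (real \<Rightarrow> real ^ 'n)
    \<Rightarrow> real \<Rightarrow> 'a \<Rightarrow> real ^ 'n"
  where "normalised_sum x h m A T \<omega> =
    (1 / sqrt T) *\<^sub>R (path_integral x T \<omega> - weighted_integral h m T A)"

definition mean_square_matrix ::
  "(real \<Rightarrow> nat) \<Rightarrow> (real \<Rightarrow> real \<Rightarrow> real) \<Rightarrow> (real \<Rightarrow> real ^ 'n) \<Rightarrow> real \<Rightarrow> real ^ 'n ^ 'n"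
  where "mean_square_matrix h m \<sigma> T =
    (1 / T) *\<^sub>R weighted_integral h m T (\<lambda>s. outer_square (\<sigma> s))"

text \<open>The condition \<open>r s t = o(t\<^sup>T t)\<close> as \<open>t \<rightarrow> 0\<close>, uniformly over all \<open>s\<close> that occur in some
  \<open>[1, h T]\<close>. A rate depending on \<open>s\<close> would not control the integral over \<open>s\<close>.\<close>

definition uniform_little_o_quadratic :: "(real \<Rightarrow> nat) \<Rightarrow> (real \<Rightarrow> real ^ 'n \<Rightarrow> complex) \<Rightarrow> bool"
  where "uniform_little_o_quadratic h r \<longleftrightarrow>
    (\<forall>\<epsilon>>0. \<forall>\<^sub>F t in at 0. \<forall>T\<ge>0. \<forall>s\<in>{1..real (h T)}. norm (r s t) \<le> \<epsilon> * (t \<bullet> t))"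

end

theory Submission
  imports Defs
begin

text \<open>
  For fixed \<open>t\<close>, substituting \<open>t / sqrt T\<close> into the factorisation turns the characteristic function
  of the normalised sum into \<open>c(t / sqrt T) exp (- t\<^sup>T V t / 2 + o(1)) + d\<close> with \<open>V\<close> the mean square
  matrix at time \<open>T\<close>. The error \<open>d\<close> is small only for almost every argument, so \<open>t\<close> is replaced by a nearby good
  point, which continuity of the characteristic function permits. Taking \<open>t = 0\<close> in the limit
  gives \<open>c(0) = 1\<close>, and characteristic functions being bounded by \<open>1\<close> makes the limit matrix positive
  semidefinite, so that the limit law exists even though the weights \<open>m\<close> may be negative. Weak convergence
  follows from Levy's continuity theorem, proved by smoothing test functions with a small Gaussian.
\<close>

subsection \<open>Characteristic functions of Gaussian laws\<close>

text \<open>The scaling by \<open>sqrt T\<close> balances two rates: at \<open>t / sqrt T\<close>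
  the remainder is \<open>o(1 / T)\<close> uniformly in \<open>s\<close>, while the weights
  contribute a total variation of order \<open>T\<close>. It has to be the total variation, because
  a signed weight can integrate to \<open>T\<close> and still amplify the remainder without limit.

  Gaussian smoothing suits the continuity theorem because the Gaussian is its own Fourier transform
  up to scaling: a Gaussian kernel integrated against a law is an average of the characteristic
  function of that law, so pointwise convergence of characteristic functions passes through by
  dominated convergence. Tightness comes from the limit being a probability law: convergence of the
  integral of one cutoff function already bounds the mass that lies far out.

  The limits are taken along sequences, since dominated convergence and the compactness argument are
  sequential; convergence over all real times is recovered at the end.\<close>

lemma prod_Basis_vec:
  fixes z :: "real ^ 'n" and f :: "'n \<Rightarrow> real \<Rightarrow> 'b::comm_monoid_mult"
  shows "(\<Prod>i\<in>UNIV. f i (z $ i)) = (\<Prod>b\<in>Basis. f (axis_index b) (z \<bullet> b))"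
proof -
  have B: "(Basis :: (real ^ 'n) set) = (\<lambda>i. axis i 1) ` UNIV"
    by (auto simp: Basis_vec_def)
  have "inj (\<lambda>i::'n. axis i (1::real))"
    by (auto simp: inj_def axis_eq_axis)
  then show ?thesis
    unfolding B by (subst prod.reindex) (auto simp: cart_eq_inner_axis intro!: prod.cong)
qed

text \<open>By \<open>lborel_eq\<close>, \<open>lborel\<close> on vectors is the image of a product
  measure indexed by \<open>Basis\<close>. Once the product over coordinates is rewritten as a
  product over \<open>Basis\<close>, both claims are the product rules for finite product
  measures.\<close>

lemma
  fixes f :: "'n::finite \<Rightarrow> real \<Rightarrow> 'b::{real_normed_field, banach, second_countable_topology}"
  assumes int: "\<And>i. integrable lborel (f i)"
  shows integrable_lborel_vec_prod: "integrable lborel (\<lambda>z::real^'n. \<Prod>i\<in>UNIV. f i (z $ i))"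
    and integral_lborel_vec_prod:
      "(LINT z|lborel. (\<Prod>i\<in>UNIV. f i ((z::real^'n) $ i))) = (\<Prod>i\<in>UNIV. LINT x|lborel. f i x)"
proof -
  interpret product_sigma_finite "\<lambda>_::real^'n. lborel :: real measure"
    by unfold_locales
  let ?S = "\<lambda>g::real^'n \<Rightarrow> real. \<Sum>b\<in>Basis. g b *\<^sub>R b"
  have [measurable]: "f i \<in> borel_measurable borel" for i
    using borel_measurable_integrable[OF int[of i]] by simp
  have S[measurable]: "?S \<in> measurable (\<Pi>\<^sub>M b\<in>Basis. lborel) borel"
    by measurable
  have m: "(\<lambda>z::real^'n. \<Prod>b\<in>Basis. f (axis_index b) (z \<bullet> b)) \<in> borel_measurable borel"
    by measurable
  have eq: "(\<Prod>b\<in>Basis. f (axis_index b) (?S g \<bullet> b)) = (\<Prod>b\<in>Basis. f (axis_index b) (g b))" for g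
    by (intro prod.cong refl) simp
  show "integrable lborel (\<lambda>z::real^'n. \<Prod>i\<in>UNIV. f i (z $ i))"
    unfolding prod_Basis_vec
    by (subst lborel_eq, subst integrable_distr_eq[OF S m], unfold eq)
       (intro product_integrable_prod int finite_Basis)
  have "(LINT z|lborel. (\<Prod>i\<in>UNIV. f i ((z::real^'n) $ i)))
      = (\<Prod>b\<in>(Basis::(real^'n) set). LINT x|lborel. f (axis_index b) x)"
    unfolding prod_Basis_vec
    by (subst lborel_eq, subst integral_distr[OF S m], unfold eq)
       (intro product_integral_prod int finite_Basis)
  also have "\<dots> = (\<Prod>i\<in>UNIV. LINT x|lborel. f i x)"
    using prod_Basis_vec[of "\<lambda>i _. LINT x|lborel. f i x" "0 :: real^'n"] by simp
  finally show "(LINT z|lborel. (\<Prod>i\<in>UNIV. f i ((z::real^'n) $ i))) = (\<Prod>i\<in>UNIV. LINT x|lborel. f i x)" .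
qed

section \<open>The standard Gaussian law\<close>

lemma sets_std_gaussian [simp, measurable_cong]: "sets std_gaussian = sets borel"
  by (simp add: std_gaussian_def)

lemma space_std_gaussian [simp]: "space std_gaussian = UNIV"
  by (simp add: std_gaussian_def)

lemma std_normal_prod_nonneg: "0 \<le> (\<Prod>i\<in>UNIV. std_normal_density ((z::real^'n) $ i))"
  by (intro prod_nonneg) simp

lemma std_normal_prod_eq:
  fixes z :: "real ^ 'n"
  shows "(\<Prod>i\<in>UNIV. std_normal_density (z $ i))
    = (1 / sqrt (2 * pi)) ^ CARD('n) * exp (- (norm z)\<^sup>2 / 2)"
proof -
  have "(\<Prod>i\<in>UNIV. std_normal_density (z $ i))
    = (\<Prod>i\<in>(UNIV::'n set). 1 / sqrt (2 * pi)) * (\<Prod>i\<in>UNIV. exp (- (z $ i)\<^sup>2 / 2))"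
    unfolding std_normal_density_def prod.distrib ..
  also have "(\<Prod>i\<in>UNIV. exp (- (z $ i)\<^sup>2 / 2)) = exp (\<Sum>i\<in>UNIV. - (z $ i)\<^sup>2 / 2)"
    by (simp add: exp_sum)
  also have "(\<Sum>i\<in>UNIV. - (z $ i)\<^sup>2 / 2) = - (norm z)\<^sup>2 / 2"
    by (simp add: norm_vec_def L2_set_def sum_nonneg sum_negf sum_divide_distrib[symmetric])
  finally show ?thesis by simp
qed

lemma std_normal_prod_measurable [measurable]:
  "(\<lambda>z::real^'n. \<Prod>i\<in>UNIV. std_normal_density (z $ i)) \<in> borel_measurable borel"
  unfolding std_normal_prod_eq by measurable

lemma prob_space_std_gaussian: "prob_space (std_gaussian :: (real^'n) measure)"
proof
  have "(\<integral>\<^sup>+ z. ennreal (\<Prod>i\<in>UNIV. std_normal_density ((z::real^'n) $ i)) \<partial>lborel)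
    = ennreal (LINT z|lborel. (\<Prod>i\<in>UNIV. std_normal_density ((z::real^'n) $ i)))"
    by (intro nn_integral_eq_integral integrable_lborel_vec_prod)
       (simp_all add: std_normal_prod_nonneg)
  also have "\<dots> = 1"
    by (subst integral_lborel_vec_prod) simp_all
  finally show "emeasure (std_gaussian :: (real^'n) measure) (space std_gaussian) = 1"
    by (simp add: std_gaussian_def emeasure_density)
qed

section \<open>Characteristic functions of laws on vectors\<close>

definition vec_char :: "(real ^ 'n) measure \<Rightarrow> real ^ 'n \<Rightarrow> complex"
  where "vec_char P t = (CLINT x|P. iexp (t \<bullet> x))"

text \<open>Density and exponential both factor over the coordinates, which reduces the claim to the
  one-dimensional formula \<open>char_std_normal_distribution\<close>.\<close>

lemma vec_char_std_gaussian:
  "vec_char std_gaussian (t :: real ^ 'n) = complex_of_real (exp (- (norm t)\<^sup>2 / 2))"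
proof -
  have 1: "(CLINT x|lborel. std_normal_density x *\<^sub>R iexp (u * x)) = complex_of_real (exp (- u\<^sup>2 / 2))" for u
  proof -
    have "char std_normal_distribution u = (CLINT x|lborel. std_normal_density x *\<^sub>R iexp (u * x))"
      unfolding char_def by (subst integral_density) (auto intro!: AE_I2)
    then show ?thesis by (simp add: char_std_normal_distribution exp_of_real)
  qed
  have 2: "integrable lborel (\<lambda>x. std_normal_density x *\<^sub>R iexp (u * x))" for u
    by (rule Bochner_Integration.integrable_bound[of _ std_normal_density])
       (simp_all add: norm_exp_i_times)
  have "vec_char std_gaussian t
      = (CLINT z|lborel. (\<Prod>i\<in>UNIV. std_normal_density (z $ i)) *\<^sub>R iexp (t \<bullet> z))"
    unfolding vec_char_def std_gaussian_def
    by (subst integral_density) (auto intro!: AE_I2 std_normal_prod_nonneg)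
  also have "\<dots> = (CLINT z|lborel. \<Prod>i\<in>UNIV. std_normal_density (z $ i) *\<^sub>R iexp (t $ i * z $ i))"
    by (simp add: scaleR_conv_of_real prod.distrib inner_vec_def exp_sum[symmetric] sum_distrib_left)
  also have "\<dots> = (\<Prod>i\<in>UNIV. complex_of_real (exp (- (t $ i)\<^sup>2 / 2)))"
    by (subst integral_lborel_vec_prod[OF 2]) (simp only: 1)
  also have "\<dots> = complex_of_real (exp (\<Sum>i\<in>UNIV. - (t $ i)\<^sup>2 / 2))"
    by (simp add: exp_sum)
  also have "(\<Sum>i\<in>UNIV. - (t $ i)\<^sup>2 / 2) = - (norm t)\<^sup>2 / 2"
    by (simp add: norm_vec_def L2_set_def sum_nonneg sum_negf sum_divide_distrib[symmetric])
  finally show ?thesis .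
qed

lemma integrable_iexp_inner:
  assumes "finite_measure P" "f \<in> borel_measurable P"
  shows "integrable P (\<lambda>x. iexp (f x))"
proof -
  interpret finite_measure P by fact
  show ?thesis using assms(2)
    by (intro integrable_const_bound[of _ 1]) (auto simp: norm_exp_i_times)
qed

lemma norm_vec_char_le:
  assumes "prob_space P"
  shows "norm (vec_char P t) \<le> 1"
proof -
  interpret prob_space P by fact
  have "norm (vec_char P t) \<le> (LINT x|P. norm (iexp (t \<bullet> x)))"
    unfolding vec_char_def by (rule integral_norm_bound)
  then show ?thesis by (simp add: prob_space)
qed

lemma vec_char_0:
  assumes "prob_space P" shows "vec_char P 0 = 1"
proof -
  interpret prob_space P by fact
  show ?thesis by (simp add: vec_char_def prob_space)
qed

lemma isCont_vec_char:
  assumes "prob_space P" and [simp, measurable_cong]: "sets P = sets borel"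
  shows "isCont (vec_char P) t"
proof -
  interpret prob_space P by fact
  show ?thesis
    unfolding continuous_at_sequentially comp_def
  proof (intro allI impI)
    fix u :: "nat \<Rightarrow> real ^ 'a" assume u: "u \<longlonglongrightarrow> t"
    show "(\<lambda>n. vec_char P (u n)) \<longlonglongrightarrow> vec_char P t"
      unfolding vec_char_def
    proof (rule integral_dominated_convergence[where w = "\<lambda>_. 1"])
      show "AE x in P. (\<lambda>n. iexp (u n \<bullet> x)) \<longlonglongrightarrow> iexp (t \<bullet> x)"
        by (intro AE_I2 tendsto_intros u)
    qed (auto simp: norm_exp_i_times)
  qed
qed

lemma vec_char_measurable [measurable]:
  assumes "prob_space P" and "sets P = sets borel"
  shows "vec_char P \<in> borel_measurable borel"
  by (intro borel_measurable_continuous_onI continuous_at_imp_continuous_on)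
     (simp add: isCont_vec_char[OF assms])

text \<open>Moving \<open>B\<close> across the inner product evaluates the standard characteristic
  function at \<open>transpose B *v t\<close>, whose squared norm is the quadratic form of
  \<open>B ** transpose B\<close>.\<close>

lemma
  assumes "is_gaussian 0 \<Sigma> N"
  shows is_gaussian_prob_space: "prob_space N"
    and is_gaussian_sets: "sets N = sets borel"
    and vec_char_gaussian: "vec_char N t = exp (- complex_of_real ((t \<bullet> (\<Sigma> *v t)) / 2))"
proof -
  obtain B :: "real ^ 'a ^ 'a" where B: "B ** transpose B = \<Sigma>"
    and N: "N = distr std_gaussian borel (\<lambda>z. 0 + B *v z)"
    using assms unfolding is_gaussian_def by blast
  have [measurable]: "(\<lambda>z. B *v z) \<in> borel_measurable borel"
    by (intro borel_measurable_continuous_onI matrix_vector_mult_linear_continuous_on)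
  interpret prob_space "std_gaussian :: (real ^ 'a) measure" by (rule prob_space_std_gaussian)
  show "prob_space N" unfolding N by (intro prob_space_distr) simp
  show "sets N = sets borel" by (simp add: N)
  have "vec_char N t = (CLINT z|std_gaussian. iexp (t \<bullet> (B *v z)))"
    unfolding vec_char_def N by (subst integral_distr) simp_all
  also have "\<dots> = vec_char std_gaussian (transpose B *v t)"
    unfolding vec_char_def
    by (simp add: dot_lmul_matrix[symmetric])
  also have "\<dots> = exp (- complex_of_real ((t \<bullet> (\<Sigma> *v t)) / 2))"
    unfolding vec_char_std_gaussian
    by (simp add: power2_norm_eq_inner B[symmetric] dot_lmul_matrix
        matrix_vector_mul_assoc[symmetric] flip: exp_of_real)
  finally show "vec_char N t = exp (- complex_of_real ((t \<bullet> (\<Sigma> *v t)) / 2))" .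
qed

subsection \<open>Continuity theorem\<close>

text \<open>The kernel is itself the characteristic function of \<open>std_gaussian\<close> at
  \<open>a *\<^sub>R (y - x)\<close>; Fubini then integrates over \<open>x\<close> first. Hence the
  left side depends on \<open>P\<close> only through \<open>vec_char P\<close>.\<close>

lemma gaussian_kernel_integral:
  fixes y :: "real ^ 'n"
  assumes "prob_space P" and [simp, measurable_cong]: "sets P = sets borel"
  shows "complex_of_real (LINT x|P. exp (- (norm (a *\<^sub>R (y - x)))\<^sup>2 / 2))
    = (CLINT z|std_gaussian. iexp (a * (z \<bullet> y)) * vec_char P (- (a *\<^sub>R z)))"
proof -
  interpret P: prob_space P by fact
  interpret G: prob_space "std_gaussian :: (real ^ 'n) measure" by (rule prob_space_std_gaussian)
  interpret PG: pair_prob_space P "std_gaussian :: (real ^ 'n) measure" ..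
  have int: "integrable (P \<Otimes>\<^sub>M std_gaussian) (\<lambda>(x, z). iexp ((a *\<^sub>R (y - x)) \<bullet> z))"
    unfolding case_prod_beta
    by (intro integrable_iexp_inner PG.finite_measure) measurable
  have "complex_of_real (LINT x|P. exp (- (norm (a *\<^sub>R (y - x)))\<^sup>2 / 2))
    = (CLINT x|P. (CLINT z|std_gaussian. iexp ((a *\<^sub>R (y - x)) \<bullet> z)))"
    unfolding integral_complex_of_real[symmetric] vec_char_std_gaussian[symmetric] vec_char_def ..
  also have "\<dots> = (CLINT z|std_gaussian. (CLINT x|P. iexp ((a *\<^sub>R (y - x)) \<bullet> z)))"
    using PG.Fubini_integral[OF int] by simp
  also have "\<dots> = (CLINT z|std_gaussian. iexp (a * (z \<bullet> y)) * vec_char P (- (a *\<^sub>R z)))"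
  proof (intro Bochner_Integration.integral_cong refl)
    fix z
    have "iexp ((a *\<^sub>R (y - x)) \<bullet> z) = iexp (a * (z \<bullet> y)) * iexp ((- (a *\<^sub>R z)) \<bullet> x)" for x
      unfolding exp_add[symmetric]
      by (simp add: inner_diff_left inner_commute algebra_simps)
    then show "(CLINT x|P. iexp ((a *\<^sub>R (y - x)) \<bullet> z)) = iexp (a * (z \<bullet> y)) * vec_char P (- (a *\<^sub>R z))"
      by (simp add: vec_char_def)
  qed
  finally show ?thesis .
qed

lemma gaussian_kernel_tendsto:
  fixes y :: "real ^ 'n"
  assumes P: "\<And>n. prob_space (P n)" "\<And>n. sets (P n) = sets borel"
    and N: "prob_space N" "sets N = sets borel"
    and char: "\<And>t. (\<lambda>n. vec_char (P n) t) \<longlonglongrightarrow> vec_char N t"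
  shows "(\<lambda>n. LINT x|P n. exp (- (norm (a *\<^sub>R (y - x)))\<^sup>2 / 2))
    \<longlonglongrightarrow> (LINT x|N. exp (- (norm (a *\<^sub>R (y - x)))\<^sup>2 / 2))"
proof -
  interpret G: prob_space "std_gaussian :: (real ^ 'n) measure" by (rule prob_space_std_gaussian)
  note [measurable] = vec_char_measurable[OF P] vec_char_measurable[OF N]
  have "(\<lambda>n. CLINT z|std_gaussian. iexp (a * (z \<bullet> y)) * vec_char (P n) (- (a *\<^sub>R z)))
    \<longlonglongrightarrow> (CLINT z|std_gaussian. iexp (a * (z \<bullet> y)) * vec_char N (- (a *\<^sub>R z)))"
  proof (rule integral_dominated_convergence[where w = "\<lambda>_. 1"])
    show "AE z in std_gaussian. (\<lambda>n. iexp (a * (z \<bullet> y)) * vec_char (P n) (- (a *\<^sub>R z)))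
      \<longlonglongrightarrow> iexp (a * (z \<bullet> y)) * vec_char N (- (a *\<^sub>R z))"
      by (intro AE_I2 tendsto_intros char)
    show "AE z in std_gaussian. norm (iexp (a * (z \<bullet> y)) * vec_char (P n) (- (a *\<^sub>R z))) \<le> 1" for n
      by (intro AE_I2) (simp add: norm_mult norm_exp_i_times norm_vec_char_le[OF P(1)])
  qed simp_all
  then show ?thesis
    unfolding gaussian_kernel_integral[OF P, symmetric] gaussian_kernel_integral[OF N, symmetric]
    by (simp add: tendsto_of_real_iff)
qed

text \<open>The substitution \<open>y = x + e z\<close> exhibits smoothing by \<open>e z\<close> as
  convolution with the kernel above for \<open>a = 1 / e\<close>. Its Jacobian supplies one factor
  \<open>1 / e\<close> per coordinate.\<close>

lemma integral_std_gaussian_affine: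
  fixes f :: "real ^ 'n \<Rightarrow> real"
  assumes [measurable]: "f \<in> borel_measurable borel" and e: "e > 0"
  shows "(LINT z|std_gaussian. f (x + e *\<^sub>R z))
    = (1 / sqrt (2 * pi) / e) ^ CARD('n) * (LINT y|lborel. f y * exp (- (norm ((1/e) *\<^sub>R (y - x)))\<^sup>2 / 2))"
proof -
  let ?K = "(1 / sqrt (2 * pi)) ^ CARD('n)"
  let ?g = "\<lambda>y. f y * exp (- (norm ((1/e) *\<^sub>R (y - x)))\<^sup>2 / 2)"
  have "(LINT y|lborel. ?g y) = (LINT y|density (distr lborel borel (\<lambda>z. x + e *\<^sub>R z)) (\<lambda>_. \<bar>e\<bar> ^ DIM(real ^ 'n)). ?g y)"
    using lborel_affine[of e x] e by simp
  also have "\<dots> = e ^ CARD('n) * (LINT z|lborel. ?g (x + e *\<^sub>R z))"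
    using e by (subst integral_density) (auto simp: integral_distr)
  also have "(LINT z|lborel. ?g (x + e *\<^sub>R z)) = (LINT z|lborel. f (x + e *\<^sub>R z) * exp (- (norm z)\<^sup>2 / 2))"
    using e by simp
  finally have *: "(LINT y|lborel. ?g y) = e ^ CARD('n) * (LINT z|lborel. f (x + e *\<^sub>R z) * exp (- (norm z)\<^sup>2 / 2))" .
  have "(LINT z|std_gaussian. f (x + e *\<^sub>R z))
      = (LINT z|lborel. (\<Prod>i\<in>UNIV. std_normal_density (z $ i)) *\<^sub>R f (x + e *\<^sub>R z))"
    unfolding std_gaussian_def
    by (subst integral_density) (auto intro!: AE_I2 std_normal_prod_nonneg)
  also have "\<dots> = (LINT z|lborel. ?K * (f (x + e *\<^sub>R z) * exp (- (norm z)\<^sup>2 / 2)))"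
    unfolding std_normal_prod_eq by (simp add: mult_ac)
  also have "\<dots> = ?K * (LINT z|lborel. f (x + e *\<^sub>R z) * exp (- (norm z)\<^sup>2 / 2))"
    by simp
  also have "\<dots> = (1 / sqrt (2 * pi) / e) ^ CARD('n) * (LINT y|lborel. ?g y)"
    unfolding * using e by (simp add: power_divide power_mult_distrib)
  finally show ?thesis .
qed

text \<open>Exchanging the integrals leaves the kernel integrals against \<open>P n\<close> inside a
  Lebesgue integral weighted by \<open>f\<close>. They converge pointwise and are at most
  \<open>1\<close>, so \<open>\<bar>f\<bar>\<close> dominates; this is where Lebesgue integrability
  of \<open>f\<close> enters.\<close>

lemma gaussian_smoothing_tendsto:
  fixes f :: "real ^ 'n \<Rightarrow> real"
  assumes P: "\<And>n. prob_space (P n)" "\<And>n. sets (P n) = sets borel"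
    and N: "prob_space N" "sets N = sets borel"
    and char: "\<And>t. (\<lambda>n. vec_char (P n) t) \<longlonglongrightarrow> vec_char N t"
    and f: "integrable lborel f" and e: "e > 0"
  shows "(\<lambda>n. LINT x|P n. (LINT z|std_gaussian. f (x + e *\<^sub>R z)))
    \<longlonglongrightarrow> (LINT x|N. (LINT z|std_gaussian. f (x + e *\<^sub>R z)))"
proof -
  have [measurable]: "f \<in> borel_measurable borel"
    using borel_measurable_integrable[OF f] by simp
  let ?K = "(1 / sqrt (2 * pi) / e) ^ CARD('n)"
  let ?k = "\<lambda>(x::real^'n) y. exp (- (norm ((1/e) *\<^sub>R (y - x)))\<^sup>2 / 2) :: real"
  have swap: "(LINT x|Q. (LINT z|std_gaussian. f (x + e *\<^sub>R z)))
      = ?K * (LINT y|lborel. f y * (LINT x|Q. ?k x y))"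
    if "prob_space Q" and [simp, measurable_cong]: "sets Q = sets borel" for Q
  proof -
    interpret Q: prob_space Q by fact
    interpret QL: pair_sigma_finite Q "lborel :: (real ^ 'n) measure" ..
    \<comment> \<open>\<open>Q\<close> is finite, so a function integrable in \<open>y\<close> alone
      is integrable on the product; the kernel lies between \<open>0\<close> and \<open>1\<close>
      and preserves this.\<close>
    have "integrable (Q \<Otimes>\<^sub>M lborel) (\<lambda>(x, y). f y)"
      using f by (intro QL.Fubini_integrable) (auto simp: case_prod_beta)
    then have int: "integrable (Q \<Otimes>\<^sub>M lborel) (\<lambda>(x, y). f y * ?k x y)"
      by (rule Bochner_Integration.integrable_bound)
         (auto intro!: AE_I2 mult_left_le simp: abs_mult)
    have "(LINT x|Q. (LINT z|std_gaussian. f (x + e *\<^sub>R z))) = ?K * (LINT x|Q. (LINT y|lborel. f y * ?k x y))"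
      by (subst integral_std_gaussian_affine[OF _ e]) simp_all
    also have "(LINT x|Q. (LINT y|lborel. f y * ?k x y)) = (LINT y|lborel. (LINT x|Q. f y * ?k x y))"
      using QL.Fubini_integral[OF int] by simp
    finally show ?thesis by simp
  qed
  have "(\<lambda>n. LINT y|lborel. f y * (LINT x|P n. ?k x y)) \<longlonglongrightarrow> (LINT y|lborel. f y * (LINT x|N. ?k x y))"
  proof (rule integral_dominated_convergence[where w = "\<lambda>y. \<bar>f y\<bar>"])
    have m: "(\<lambda>y. LINT x|Q. ?k x y) \<in> borel_measurable borel"
      if "prob_space Q" and [simp, measurable_cong]: "sets Q = sets borel" for Q
    proof -
      interpret Q: prob_space Q by fact
      have "(\<lambda>(y, x). ?k x y) \<in> borel_measurable (borel \<Otimes>\<^sub>M Q)"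
        unfolding case_prod_beta by measurable
      then show ?thesis by (rule Q.borel_measurable_lebesgue_integral)
    qed
    note [measurable] = m[OF P] m[OF N]
    show "(\<lambda>y. f y * (LINT x|N. ?k x y)) \<in> borel_measurable lborel" by measurable
    show "(\<lambda>y. f y * (LINT x|P n. ?k x y)) \<in> borel_measurable lborel" for n by measurable
    show "integrable lborel (\<lambda>y. \<bar>f y\<bar>)" using f by simp
    show "AE y in lborel. (\<lambda>n. f y * (LINT x|P n. ?k x y)) \<longlonglongrightarrow> f y * (LINT x|N. ?k x y)"
      by (intro AE_I2 tendsto_intros gaussian_kernel_tendsto P N char)
    show "AE y in lborel. norm (f y * (LINT x|P n. ?k x y)) \<le> \<bar>f y\<bar>" for n
    proof (intro AE_I2)
      fix y
      interpret P: prob_space "P n" by (rule P)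
      have "\<bar>LINT x|P n. ?k x y\<bar> \<le> (LINT x|P n. \<bar>?k x y\<bar>)" by (rule integral_abs_bound)
      also have "\<dots> \<le> 1"
        by (intro P.integral_le_const P.integrable_const_bound[of _ 1])
           (auto simp: measurable_cong_sets[OF P(2) refl])
      finally show "norm (f y * (LINT x|P n. ?k x y)) \<le> \<bar>f y\<bar>"
        by (simp add: abs_mult mult_left_le)
    qed
  qed
  then show ?thesis
    unfolding swap[OF P] swap[OF N] by (rule tendsto_mult_left)
qed

text \<open>Small displacements are handled by uniform continuity, large ones by their small
  Gaussian mass; neither estimate involves \<open>x\<close>.\<close>

lemma gaussian_smoothing_uniform:
  fixes f :: "real ^ 'n \<Rightarrow> real"
  assumes unif: "uniformly_continuous_on UNIV f" and bound: "\<And>x. \<bar>f x\<bar> \<le> B" and "\<delta> > 0"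
  obtains e where "e > 0" "\<And>x. \<bar>(LINT z|std_gaussian. f (x + e *\<^sub>R z)) - f x\<bar> \<le> \<delta>"
proof -
  interpret G: prob_space "std_gaussian :: (real ^ 'n) measure" by (rule prob_space_std_gaussian)
  have [measurable]: "f \<in> borel_measurable borel"
    using unif by (intro borel_measurable_continuous_onI uniformly_continuous_imp_continuous)
  have B: "B \<ge> 0" using bound[of 0] by linarith
  obtain \<eta> where \<eta>: "\<eta> > 0" "\<And>x y. dist y x < \<eta> \<Longrightarrow> dist (f y) (f x) < \<delta> / 2"
    using unif \<open>\<delta> > 0\<close> unfolding uniformly_continuous_on_def
    by (metis UNIV_I half_gt_zero)
  \<comment> \<open>A continuous majorant of the indicator of displacements of size at least
    \<open>\<eta>\<close>. It tends to \<open>0\<close> pointwise as the scale shrinks, so dominated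
    convergence replaces an explicit tail estimate. Where it equals \<open>1\<close>, the crude
    bound \<open>2 * B\<close> on the oscillation of \<open>f\<close> is enough.\<close>
  let ?w = "\<lambda>n (z::real^'n). min 1 (norm ((1 / Suc n) *\<^sub>R z) / \<eta>)"
  have "(\<lambda>n. LINT z|std_gaussian. ?w n (z::real^'n)) \<longlonglongrightarrow> (LINT z::real^'n|std_gaussian. 0)"
  proof (rule integral_dominated_convergence[where w = "\<lambda>_. 1"])
    show "AE z in std_gaussian. (\<lambda>n. ?w n (z::real^'n)) \<longlonglongrightarrow> 0"
    proof (intro AE_I2)
      fix z :: "real ^ 'n"
      have "(\<lambda>n. min 1 (norm ((1 / real (Suc n)) *\<^sub>R z) / \<eta>)) \<longlonglongrightarrow> min 1 (norm (0 *\<^sub>R z) / \<eta>)"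
        using \<eta>(1) LIMSEQ_Suc[OF lim_1_over_n] by (intro tendsto_intros) simp_all
      then show "(\<lambda>n. ?w n z) \<longlonglongrightarrow> 0" by simp
    qed
  qed (use \<eta>(1) in auto)
  then have "(\<lambda>n. 2 * B * (LINT z|std_gaussian. ?w n (z::real^'n))) \<longlonglongrightarrow> 2 * B * 0"
    by (intro tendsto_intros) simp
  then have "\<forall>\<^sub>F n in sequentially. 2 * B * (LINT z|std_gaussian. ?w n (z::real^'n)) < \<delta> / 2"
    using \<open>\<delta> > 0\<close> by (intro order_tendstoD(2)[of _ "2 * B * 0"]) auto
  then obtain n where n: "2 * B * (LINT z|std_gaussian. ?w n (z::real^'n)) < \<delta> / 2"
    by (auto simp: eventually_sequentially)
  define e where "e = 1 / real (Suc n)"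
  have e: "e > 0" by (simp add: e_def)
  have pt: "\<bar>f (x + e *\<^sub>R z) - f x\<bar> \<le> \<delta> / 2 + 2 * B * ?w n z" for x z
  proof (cases "norm (e *\<^sub>R z) < \<eta>")
    case True
    then have "\<bar>f (x + e *\<^sub>R z) - f x\<bar> < \<delta> / 2"
      using \<eta>(2)[of "x + e *\<^sub>R z" x] by (simp add: dist_norm)
    moreover have "0 \<le> 2 * B * ?w n z" using B \<eta>(1) by simp
    ultimately show ?thesis by linarith
  next
    case False
    then have "?w n z = 1" using \<eta>(1) unfolding e_def[symmetric] by (simp add: min_def field_simps)
    then show ?thesis using bound[of "x + e *\<^sub>R z"] bound[of x] \<open>\<delta> > 0\<close> by simp
  qed
  have int: "integrable std_gaussian (\<lambda>z. f (x + e *\<^sub>R z))" for x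
    by (intro G.integrable_const_bound[of _ B]) (auto simp: bound)
  have intw: "integrable std_gaussian (\<lambda>z. ?w n (z::real^'n))"
    using \<eta>(1) by (intro G.integrable_const_bound[of _ 1]) auto
  have "\<bar>(LINT z|std_gaussian. f (x + e *\<^sub>R z)) - f x\<bar> \<le> \<delta>" for x
  proof -
    have "(LINT z|std_gaussian. f (x + e *\<^sub>R z)) - f x = (LINT z|std_gaussian. f (x + e *\<^sub>R z) - f x)"
      using int[of x] G.prob_space by simp
    also have "\<bar>\<dots>\<bar> \<le> (LINT z|std_gaussian. \<bar>f (x + e *\<^sub>R z) - f x\<bar>)"
      by (rule integral_abs_bound)
    also have "\<dots> \<le> (LINT z|std_gaussian. \<delta> / 2 + 2 * B * ?w n (z::real^'n))"
      using int[of x] intw pt by (intro integral_mono) auto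
    also have "\<dots> = \<delta> / 2 + 2 * B * (LINT z|std_gaussian. ?w n (z::real^'n))"
      using intw G.prob_space by simp
    also have "\<dots> \<le> \<delta>" using n by linarith
    finally show ?thesis .
  qed
  with e that show ?thesis by blast
qed

section \<open>From compactly supported to bounded continuous test functions\<close>

text \<open>Compact support provides at once the boundedness and uniform continuity that make
  smoothing uniformly accurate, and the Lebesgue integrability that makes smoothed integrals
  converge.\<close>

lemma vec_char_tendsto_imp_compact_support:
  fixes f :: "real ^ 'n \<Rightarrow> real"
  assumes P: "\<And>n. prob_space (P n)" "\<And>n. sets (P n) = sets borel"
    and N: "prob_space N" "sets N = sets borel"
    and char: "\<And>t. (\<lambda>n. vec_char (P n) t) \<longlonglongrightarrow> vec_char N t"
    and f: "continuous_on UNIV f" and supp: "\<And>x. norm x > R \<Longrightarrow> f x = 0"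
  shows "(\<lambda>n. LINT x|P n. f x) \<longlonglongrightarrow> (LINT x|N. f x)"
proof (rule LIMSEQ_I)
  fix r :: real assume r: "r > 0"
  have fm: "f \<in> borel_measurable borel" using f by (rule borel_measurable_continuous_onI)
  have "bounded (f ` cball 0 R)"
    by (intro compact_imp_bounded compact_continuous_image continuous_on_subset[OF f]) auto
  then obtain B where B: "\<And>x. norm x \<le> R \<Longrightarrow> \<bar>f x\<bar> \<le> B"
    unfolding bounded_iff by (metis imageI mem_cball_0 real_norm_def)
  have bound: "\<bar>f x\<bar> \<le> max B 0" for x
    using B[of x] supp[of x] by (cases "norm x \<le> R") auto
  \<comment> \<open>Two points at distance below \<open>1\<close> either both lie in the ball of
    radius \<open>R + 1\<close>, which is compact, or both lie outside the ball of radius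
    \<open>R\<close>, where \<open>f\<close> vanishes.\<close>
  have unif: "uniformly_continuous_on UNIV f"
    unfolding uniformly_continuous_on_def
  proof (intro allI impI)
    fix \<epsilon> :: real assume "\<epsilon> > 0"
    moreover have "uniformly_continuous_on (cball 0 (R + 1)) f"
      by (intro compact_uniformly_continuous continuous_on_subset[OF f]) auto
    ultimately obtain \<delta> where \<delta>: "\<delta> > 0"
      "\<And>x y. norm x \<le> R + 1 \<Longrightarrow> norm y \<le> R + 1 \<Longrightarrow> dist y x < \<delta> \<Longrightarrow> dist (f y) (f x) < \<epsilon>"
      unfolding uniformly_continuous_on_def by (metis mem_cball_0)
    have "dist (f y) (f x) < \<epsilon>" if d: "dist y x < min \<delta> 1" for x y
    proof (cases "norm x \<le> R + 1 \<and> norm y \<le> R + 1")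
      case True
      then show ?thesis using \<delta>(2) d by auto
    next
      case False
      moreover have "\<bar>norm y - norm x\<bar> < 1"
        using d norm_triangle_ineq3[of y x] by (simp add: dist_norm)
      ultimately have "norm x > R" "norm y > R" by auto
      then show ?thesis using supp \<open>\<epsilon> > 0\<close> by simp
    qed
    then show "\<exists>\<delta>>0. \<forall>x\<in>UNIV. \<forall>y\<in>UNIV. dist y x < \<delta> \<longrightarrow> dist (f y) (f x) < \<epsilon>"
      using \<delta>(1) by (intro exI[of _ "min \<delta> 1"]) auto
  qed
  have "integrable lborel (\<lambda>x. indicator (cball 0 R) x *\<^sub>R f x)"
    by (intro borel_integrable_compact continuous_on_subset[OF f]) auto
  moreover have "(\<lambda>x. indicator (cball 0 R) x *\<^sub>R f x) = f"
    using supp by (auto simp: indicator_def fun_eq_iff not_le)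
  ultimately have intf: "integrable lborel f" by simp
  \<comment> \<open>Three errors share the budget \<open>r\<close>: smoothing under
    \<open>P n\<close>, smoothing under \<open>N\<close>, and the distance of the smoothed
    integrals, each at most \<open>r / 4\<close>.\<close>
  obtain e where e: "e > 0" and sm: "\<And>x. \<bar>(LINT z|std_gaussian. f (x + e *\<^sub>R z)) - f x\<bar> \<le> r / 4"
    using gaussian_smoothing_uniform[OF unif bound, of "r / 4"] r by auto
  let ?g = "\<lambda>x. LINT z|std_gaussian. f (x + e *\<^sub>R z)"
  have close: "\<bar>(LINT x|Q. ?g x) - (LINT x|Q. f x)\<bar> \<le> r / 4"
    if "prob_space Q" and [simp, measurable_cong]: "sets Q = sets borel" for Q
  proof -
    interpret Q: prob_space Q by fact
    interpret G: prob_space "std_gaussian :: (real ^ 'n) measure" by (rule prob_space_std_gaussian)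
    note [measurable] = fm
    have i1: "integrable Q f" by (intro Q.integrable_const_bound[of _ "max B 0"]) (auto simp: bound)
    have "\<bar>?g x\<bar> \<le> max B 0 + r / 4" for x using sm[of x] bound[of x] by linarith
    then have i2: "integrable Q ?g" by (intro Q.integrable_const_bound[of _ "max B 0 + r / 4"]) auto
    have "\<bar>(LINT x|Q. ?g x) - (LINT x|Q. f x)\<bar> = \<bar>LINT x|Q. ?g x - f x\<bar>" using i1 i2 by simp
    also have "\<dots> \<le> (LINT x|Q. \<bar>?g x - f x\<bar>)" by (rule integral_abs_bound)
    also have "\<dots> \<le> r / 4" using i1 i2 sm by (intro Q.integral_le_const) auto
    finally show ?thesis .
  qed
  have "(\<lambda>n. LINT x|P n. ?g x) \<longlonglongrightarrow> (LINT x|N. ?g x)"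
    by (rule gaussian_smoothing_tendsto[OF P N char intf e])
  then obtain n0 where n0: "\<And>n. n \<ge> n0 \<Longrightarrow> \<bar>(LINT x|P n. ?g x) - (LINT x|N. ?g x)\<bar> < r / 4"
    using r by (force dest!: LIMSEQ_D[of _ _ "r/4"])
  have "norm ((LINT x|P n. f x) - (LINT x|N. f x)) < r" if "n \<ge> n0" for n
    using n0[OF that] close[OF P, of n] close[OF N] r unfolding real_norm_def by linarith
  then show "\<exists>n0. \<forall>n\<ge>n0. norm ((LINT x|P n. f x) - (LINT x|N. f x)) < r" by blast
qed

text \<open>A cutoff that captures almost all of the mass of \<open>N\<close> is itself compactly
  supported. Its integrals under \<open>P n\<close> therefore converge, so eventually
  \<open>P n\<close> has almost no mass beyond it either, and \<open>f\<close> may be replaced by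
  its product with the cutoff under all these laws.\<close>

theorem levy_continuity_vec:
  fixes f :: "real ^ 'n \<Rightarrow> real"
  assumes P: "\<And>n. prob_space (P n)" "\<And>n. sets (P n) = sets borel"
    and N: "prob_space N" "sets N = sets borel"
    and char: "\<And>t. (\<lambda>n. vec_char (P n) t) \<longlonglongrightarrow> vec_char N t"
    and f: "continuous_on UNIV f" and "bounded (range f)"
  shows "(\<lambda>n. LINT x|P n. f x) \<longlonglongrightarrow> (LINT x|N. f x)"
proof (rule LIMSEQ_I)
  fix r :: real assume r: "r > 0"
  interpret N: prob_space N by fact
  have [simp, measurable_cong]: "sets N = sets borel" by fact
  have fm[measurable]: "f \<in> borel_measurable borel" using f by (rule borel_measurable_continuous_onI)
  obtain B where "B > 0" and B: "\<And>x. \<bar>f x\<bar> \<le> B"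
    using \<open>bounded (range f)\<close> unfolding bounded_pos by auto
  \<comment> \<open>Equal to \<open>1\<close> on the ball of radius \<open>R\<close> and to
    \<open>0\<close> outside the ball of radius \<open>R + 1\<close>.\<close>
  let ?c = "\<lambda>R (x::real^'n). max 0 (min 1 (R + 1 - norm x))"
  have cc: "continuous_on UNIV (?c R)" for R by (intro continuous_intros)
  have [measurable]: "?c R \<in> borel_measurable borel" for R
    using cc by (rule borel_measurable_continuous_onI)
  have "(\<lambda>k. LINT x|N. ?c (real k) x) \<longlonglongrightarrow> (LINT x|N. 1)"
  proof (rule integral_dominated_convergence[where w = "\<lambda>_. 1"])
    show "AE x in N. (\<lambda>k. ?c (real k) x) \<longlonglongrightarrow> 1"
    proof (intro AE_I2 tendsto_eventually)
      fix x :: "real ^ 'n"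
      obtain k0 where "norm x \<le> real k0" using real_arch_simple by blast
      then show "\<forall>\<^sub>F k in sequentially. ?c (real k) x = 1"
        by (auto simp: eventually_sequentially intro!: exI[of _ k0])
    qed
  qed auto
  then have "(\<lambda>k. LINT x|N. ?c (real k) x) \<longlonglongrightarrow> 1" by (simp add: N.prob_space)
  \<comment> \<open>With this threshold, cutting \<open>f\<close> off costs at most
    \<open>B * (r / (8 * B)) = r / 8\<close>, once under \<open>N\<close> and once under
    \<open>P n\<close>; a further \<open>r / 2\<close> is left for the cut integrals.\<close>
  then have "\<forall>\<^sub>F k in sequentially. (LINT x|N. ?c (real k) x) > 1 - r / (8 * B)"
    using r \<open>B > 0\<close> by (intro order_tendstoD(1)[of _ 1]) auto
  then obtain k where k: "(LINT x|N. ?c (real k) x) > 1 - r / (8 * B)"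
    by (auto simp: eventually_sequentially)
  let ?h = "?c (real k)"
  have cut: "\<bar>(LINT x|Q. f x) - (LINT x|Q. f x * ?h x)\<bar> \<le> B * (1 - (LINT x|Q. ?h x))"
    if "prob_space Q" and [simp, measurable_cong]: "sets Q = sets borel" for Q
  proof -
    interpret Q: prob_space Q by fact
    have i1: "integrable Q f" by (intro Q.integrable_const_bound[of _ B]) (auto simp: B)
    have i2: "integrable Q ?h" by (intro Q.integrable_const_bound[of _ 1]) auto
    have i3: "integrable Q (\<lambda>x. f x * ?h x)"
      using \<open>B > 0\<close> by (intro Q.integrable_const_bound[of _ "B * 1"]) (auto simp only: abs_mult real_norm_def intro!: AE_I2 mult_mono B, auto)
    have "\<bar>(LINT x|Q. f x) - (LINT x|Q. f x * ?h x)\<bar> = \<bar>LINT x|Q. f x - f x * ?h x\<bar>"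
      using i1 i3 by simp
    also have "\<dots> \<le> (LINT x|Q. \<bar>f x - f x * ?h x\<bar>)" by (rule integral_abs_bound)
    also have "\<dots> \<le> (LINT x|Q. B * (1 - ?h x))"
    proof (intro integral_mono)
      fix x
      have "\<bar>f x - f x * ?h x\<bar> = \<bar>f x\<bar> * \<bar>1 - ?h x\<bar>"
        unfolding abs_mult[symmetric] by (simp only: right_diff_distrib mult_1_right)
      also have "\<dots> = \<bar>f x\<bar> * (1 - ?h x)" by simp
      also have "\<dots> \<le> B * (1 - ?h x)" by (intro mult_right_mono B) simp
      finally show "\<bar>f x - f x * ?h x\<bar> \<le> B * (1 - ?h x)" .
    qed (use i1 i2 i3 in auto)
    also have "\<dots> = B * (1 - (LINT x|Q. ?h x))" using i2 by (simp add: Q.prob_space)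
    finally show ?thesis .
  qed
  have supp: "norm x > real k + 1 \<Longrightarrow> ?h x = 0" for x by simp
  have "(\<lambda>n. LINT x|P n. ?h x) \<longlonglongrightarrow> (LINT x|N. ?h x)"
    by (rule vec_char_tendsto_imp_compact_support[OF P N char cc supp])
  then have E1: "\<forall>\<^sub>F n in sequentially. (LINT x|P n. ?h x) > 1 - r / (8 * B)"
    using k by (rule order_tendstoD)
  have "(\<lambda>n. LINT x|P n. f x * ?h x) \<longlonglongrightarrow> (LINT x|N. f x * ?h x)"
    by (rule vec_char_tendsto_imp_compact_support[OF P N char continuous_on_mult[OF f cc], of "real k + 1"])
       simp
  from tendstoD[OF this, of "r / 2"]
  have E2: "\<forall>\<^sub>F n in sequentially. \<bar>(LINT x|P n. f x * ?h x) - (LINT x|N. f x * ?h x)\<bar> < r / 2"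
    using r by (simp add: dist_real_def)
  have small: "B * (1 - q) \<le> r / 8" if "q > 1 - r / (8 * B)" for q
  proof -
    have "B * (1 - q) \<le> B * (r / (8 * B))" using that \<open>B > 0\<close> by (intro mult_left_mono) auto
    then show ?thesis using \<open>B > 0\<close> by simp
  qed
  have "\<forall>\<^sub>F n in sequentially. norm ((LINT x|P n. f x) - (LINT x|N. f x)) < r"
    using E1 E2
  proof eventually_elim
    case (elim n)
    show ?case
      using elim(2) cut[OF P, of n] cut[OF N] small[OF elim(1)] small[OF k] r
      unfolding real_norm_def by linarith
  qed
  then show "\<exists>n0. \<forall>n\<ge>n0. norm ((LINT x|P n. f x) - (LINT x|N. f x)) < r"
    by (simp add: eventually_sequentially)
qed

subsection \<open>Factorisation of positive semidefinite matrices\<close>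

text \<open>Read as a quadratic polynomial in \<open>b\<close>, this is what the elimination step
  optimises; the two cross terms coincide when \<open>S\<close> is symmetric.\<close>

lemma quadratic_form_expand:
  fixes S :: "real ^ 'n ^ 'n"
  shows "(z + b *\<^sub>R axis a 1) \<bullet> (S *v (z + b *\<^sub>R axis a 1))
    = z \<bullet> (S *v z) + b * (z \<bullet> (S *v axis a 1)) + b * (S *v z) $ a + b\<^sup>2 * S $ a $ a"
  by (simp add: matrix_vector_mult_add_rdistrib matrix_vector_right_distrib inner_add_left inner_add_right
      matrix_vector_mult_scaleR inner_axis inner_axis' matrix_vector_mult_basis column_def power2_eq_square algebra_simps)

text \<open>Cholesky elimination, one column per step: subtracting \<open>v v\<^sup>T\<close> with \<open>v\<close> the scaled column
  \<open>a\<close> clears row and column \<open>a\<close> and leaves a positive semidefinite Schur complement.\<close>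

lemma psd_sum_of_squares:
  fixes S :: "real ^ 'n ^ 'n"
  assumes "finite I"
    and "\<And>i j. S $ i $ j = S $ j $ i"
    and "\<And>z. 0 \<le> z \<bullet> (S *v z)"
    and "\<And>i j. i \<notin> I \<Longrightarrow> S $ i $ j = 0"
  shows "\<exists>v :: 'n \<Rightarrow> real ^ 'n. \<forall>i j. S $ i $ j = (\<Sum>k\<in>I. v k $ i * v k $ j)"
  using assms
proof (induction I arbitrary: S)
  case empty
  then show ?case by simp
next
  case (insert a I)
  note sym = insert.prems(1) and psd = insert.prems(2) and supp = insert.prems(3)
  let ?d = "S $ a $ a"
  have Sa: "z \<bullet> (S *v axis a 1) = (S *v z) $ a" for z
  proof -
    have "z \<bullet> (S *v axis a 1) = (\<Sum>i\<in>UNIV. z $ i * S $ i $ a)"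
      by (simp add: inner_vec_def matrix_vector_mult_basis column_def)
    also have "\<dots> = (\<Sum>i\<in>UNIV. S $ a $ i * z $ i)"
      by (intro sum.cong refl) (simp add: sym[of _ a] mult.commute)
    finally show ?thesis by (simp add: matrix_vector_mult_def)
  qed
  have quad: "0 \<le> z \<bullet> (S *v z) + 2 * b * (S *v z) $ a + b\<^sup>2 * ?d" for z b
    using psd[of "z + b *\<^sub>R axis a 1"] unfolding quadratic_form_expand Sa by simp
  have d0: "0 \<le> ?d"
    using psd[of "axis a 1"] by (simp add: inner_axis' matrix_vector_mult_basis column_def)
  show ?case
  proof (cases "?d = 0")
    case True
    have "S $ a $ j = 0" for j
    proof (rule ccontr)
      assume nz: "S $ a $ j \<noteq> 0"
      have "(S *v axis j 1) $ a = S $ a $ j"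
        by (simp add: matrix_vector_mult_basis column_def)
      moreover define q where "q = axis j 1 \<bullet> (S *v axis j 1)"
      ultimately have "0 \<le> q + 2 * b * S $ a $ j" for b
        using quad[of "axis j 1" b] True by (simp add: q_def)
      \<comment> \<open>With a zero diagonal entry the form is affine in \<open>b\<close>; this
        value of \<open>b\<close> makes it \<open>-1\<close>.\<close>
      from this[of "- (q + 1) / (2 * S $ a $ j)"] show False
        using nz by (simp add: field_simps)
    qed
    then have "\<And>i j. i \<notin> I \<Longrightarrow> S $ i $ j = 0" using supp by (metis insertE)
    from insert.IH[OF sym psd this] obtain v :: "'n \<Rightarrow> real ^ 'n"
      where v: "\<forall>i j. S $ i $ j = (\<Sum>k\<in>I. v k $ i * v k $ j)" by blast
    have "S $ i $ j = (\<Sum>k\<in>insert a I. (v(a := 0)) k $ i * (v(a := 0)) k $ j)" for i j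
      using insert.hyps v by (auto intro!: sum.cong)
    then show ?thesis by blast
  next
    case False
    with d0 have d: "?d > 0" by simp
    define w :: "real ^ 'n" where "w = (\<chi> i. S $ a $ i / sqrt ?d)"
    define S' :: "real ^ 'n ^ 'n" where "S' = (\<chi> i j. S $ i $ j - w $ i * w $ j)"
    have ww: "w $ i * w $ j = S $ a $ i * S $ a $ j / ?d" for i j
      using d by (simp add: w_def)
    have wz: "w \<bullet> z = (S *v z) $ a / sqrt ?d" for z
      by (simp add: w_def inner_vec_def matrix_vector_mult_def sum_divide_distrib)
    have S'z: "z \<bullet> (S' *v z) = z \<bullet> (S *v z) - ((S *v z) $ a)\<^sup>2 / ?d" for z
    proof -
      have "S' *v z = S *v z - (w \<bullet> z) *\<^sub>R w"
        by (simp add: vec_eq_iff S'_def matrix_vector_mult_def inner_vec_def sum_distrib_right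
            flip: sum_subtractf) (simp add: algebra_simps)
      then have "z \<bullet> (S' *v z) = z \<bullet> (S *v z) - (w \<bullet> z)\<^sup>2"
        by (simp add: inner_diff_right power2_eq_square inner_commute)
      then show ?thesis using d by (simp add: wz power_divide)
    qed
    have "\<exists>v :: 'n \<Rightarrow> real ^ 'n. \<forall>i j. S' $ i $ j = (\<Sum>k\<in>I. v k $ i * v k $ j)"
    proof (rule insert.IH)
      show "S' $ i $ j = S' $ j $ i" for i j by (simp add: S'_def sym[of i j])
      \<comment> \<open>The chosen \<open>b\<close> minimises the quadratic \<open>quad\<close> in
        \<open>b\<close>, and the minimum is exactly the form of the Schur complement
        \<open>S'\<close>.\<close>
      show "0 \<le> z \<bullet> (S' *v z)" for z
        using quad[of z "- ((S *v z) $ a / ?d)"] d unfolding S'z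
        by (simp add: power2_eq_square)
      show "S' $ i $ j = 0" if "i \<notin> I" for i j
        using that supp[of i] sym[of a i] d
        by (cases "i = a") (auto simp: S'_def ww)
    qed
    then obtain v :: "'n \<Rightarrow> real ^ 'n" where v: "\<forall>i j. S' $ i $ j = (\<Sum>k\<in>I. v k $ i * v k $ j)" by blast
    have "S $ i $ j = (\<Sum>k\<in>insert a I. (v(a := w)) k $ i * (v(a := w)) k $ j)" for i j
    proof -
      have "S $ i $ j = w $ i * w $ j + S' $ i $ j" by (simp add: S'_def)
      also have "S' $ i $ j = (\<Sum>k\<in>I. (v(a := w)) k $ i * (v(a := w)) k $ j)"
        unfolding v[rule_format] using insert.hyps by (intro sum.cong) auto
      finally show ?thesis using insert.hyps by simp
    qed
    then show ?thesis by blast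
  qed
qed

lemma gaussian_exists:
  fixes S :: "real ^ 'n ^ 'n"
  assumes "\<And>i j. S $ i $ j = S $ j $ i" and "\<And>z. 0 \<le> z \<bullet> (S *v z)"
  shows "\<exists>N. is_gaussian a S N"
proof -
  obtain v :: "'n \<Rightarrow> real ^ 'n" where v: "\<forall>i j. S $ i $ j = (\<Sum>k\<in>UNIV. v k $ i * v k $ j)"
    using psd_sum_of_squares[OF finite_class.finite_UNIV, of S] assms by auto
  define B :: "real ^ 'n ^ 'n" where "B = (\<chi> i k. v k $ i)"
  have "B ** transpose B = S"
    using v by (simp add: vec_eq_iff matrix_matrix_mult_def transpose_def B_def)
  then show ?thesis unfolding is_gaussian_def by blast
qed

subsection \<open>Asymptotics of the normalised sum\<close>

text \<open>Serves to pull inner products, quadratic forms and matrix entries out of the integral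
  over \<open>s\<close>.\<close>

lemma
  assumes L: "bounded_linear L" and f: "weighted_integrable h m T f"
  shows weighted_integrable_bounded_linear: "weighted_integrable h m T (\<lambda>s. L (f s))"
    and weighted_integral_bounded_linear: "weighted_integral h m T (\<lambda>s. L (f s)) = L (weighted_integral h m T f)"
proof -
  interpret bounded_linear L by fact
  show "weighted_integrable h m T (\<lambda>s. L (f s))"
    using integrable_bounded_linear[OF L f[unfolded weighted_integrable_def set_integrable_def]]
    by (simp add: weighted_integrable_def set_integrable_def scaleR)
  show "weighted_integral h m T (\<lambda>s. L (f s)) = L (weighted_integral h m T f)"
    using integral_bounded_linear[OF L f[unfolded weighted_integrable_def set_integrable_def]]
    by (simp add: weighted_integral_def set_lebesgue_integral_def scaleR)
qed

lemma bounded_linear_quadratic_form: "bounded_linear (\<lambda>S :: real ^ 'n ^ 'n. t \<bullet> (S *v t))"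
  by (intro linear_conv_bounded_linear[THEN iffD1] linearI)
     (simp_all add: matrix_vector_mult_add_rdistrib inner_add_right scaleR_matrix_vector_assoc[symmetric])

lemma
  assumes A: "weighted_integrable h m T A" and \<sigma>: "weighted_integrable h m T (\<lambda>s. outer_square (\<sigma> s))"
  shows weighted_integrable_quadratic_exponent:
      "weighted_integrable h m T (\<lambda>s. quadratic_exponent (A s) (\<sigma> s) t)"
    and weighted_integral_quadratic_exponent:
      "weighted_integral h m T (\<lambda>s. quadratic_exponent (A s) (\<sigma> s) t)
        = \<i> * complex_of_real (t \<bullet> weighted_integral h m T A)
          - complex_of_real ((t \<bullet> (weighted_integral h m T (\<lambda>s. outer_square (\<sigma> s)) *v t)) / 2)"
proof -
  have L1: "bounded_linear (\<lambda>v. \<i> * complex_of_real (t \<bullet> v))"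
    by (rule bounded_linear_compose[OF bounded_linear_mult_right
      bounded_linear_compose[OF bounded_linear_of_real bounded_linear_inner_right]])
  have L2: "bounded_linear (\<lambda>S. complex_of_real ((t \<bullet> (S *v t)) / 2))"
    by (rule bounded_linear_compose[OF bounded_linear_of_real
      bounded_linear_compose[OF bounded_linear_divide bounded_linear_quadratic_form]])
  note 1 = weighted_integrable_bounded_linear[OF L1 A] weighted_integrable_bounded_linear[OF L2 \<sigma>]
  show "weighted_integrable h m T (\<lambda>s. quadratic_exponent (A s) (\<sigma> s) t)"
    using set_integral_diff(1)[OF 1[unfolded weighted_integrable_def]]
    by (simp add: weighted_integrable_def quadratic_exponent_def scaleR_diff_right)
  show "weighted_integral h m T (\<lambda>s. quadratic_exponent (A s) (\<sigma> s) t)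
        = \<i> * complex_of_real (t \<bullet> weighted_integral h m T A)
          - complex_of_real ((t \<bullet> (weighted_integral h m T (\<lambda>s. outer_square (\<sigma> s)) *v t)) / 2)"
    using set_integral_diff(2)[OF 1[unfolded weighted_integrable_def]]
    unfolding weighted_integral_bounded_linear[OF L1 A, symmetric] weighted_integral_bounded_linear[OF L2 \<sigma>, symmetric]
    by (simp add: weighted_integral_def quadratic_exponent_def scaleR_diff_right)
qed

text \<open>The weight may change sign, so a uniform error in the integrand is multiplied by the
  integral of \<open>\<bar>m T s\<bar>\<close>.\<close>

lemma weighted_integral_near:
  fixes f g :: "real \<Rightarrow> 'b :: {banach, second_countable_topology}"
  assumes m: "set_integrable lebesgue {1..real (h T)} (m T)"
    and f: "weighted_integrable h m T f" and g: "weighted_integrable h m T g"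
    and e: "\<And>s. s \<in> {1..real (h T)} \<Longrightarrow> norm (f s - g s) \<le> e"
  shows "norm (weighted_integral h m T f - weighted_integral h m T g)
    \<le> e * (LINT s:{1..real (h T)}|lebesgue. \<bar>m T s\<bar>)"
proof -
  note fg = set_integral_diff[OF f[unfolded weighted_integrable_def] g[unfolded weighted_integrable_def]]
  have "norm (weighted_integral h m T f - weighted_integral h m T g)
    = norm (LINT s:{1..real (h T)}|lebesgue. m T s *\<^sub>R f s - m T s *\<^sub>R g s)"
    by (simp add: weighted_integral_def fg)
  also have "\<dots> \<le> (LINT s:{1..real (h T)}|lebesgue. norm (m T s *\<^sub>R f s - m T s *\<^sub>R g s))"
    by (rule set_integral_norm_bound[OF fg(1)])
  also have "\<dots> \<le> (LINT s:{1..real (h T)}|lebesgue. e * \<bar>m T s\<bar>)"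
  proof (rule set_integral_mono)
    show "set_integrable lebesgue {1..real (h T)} (\<lambda>s. norm (m T s *\<^sub>R f s - m T s *\<^sub>R g s))"
      by (rule set_integrable_norm[OF fg(1)])
    show "set_integrable lebesgue {1..real (h T)} (\<lambda>s. e * \<bar>m T s\<bar>)"
      using m by (intro set_integrable_mult_right set_integrable_abs) 
    fix s assume "s \<in> {1..real (h T)}"
    then show "norm (m T s *\<^sub>R f s - m T s *\<^sub>R g s) \<le> e * \<bar>m T s\<bar>"
      using e[of s] by (simp add: scaleR_diff_right[symmetric] mult.commute[of e] mult_left_mono)
  qed
  also have "\<dots> = e * (LINT s:{1..real (h T)}|lebesgue. \<bar>m T s\<bar>)" by simp
  finally show ?thesis .
qed

text \<open>A nonempty open set is not Lebesgue null, so it meets the full-measure set where the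
  essential bound holds. The origin is removed as well, because the expansion of
  \<open>ln_lam\<close> is available only in a punctured neighbourhood.\<close>

lemma Linf_norm_point:
  fixes f :: "real ^ 'n \<Rightarrow> complex"
  assumes U: "U \<in> sets lebesgue" and V: "open V" "V \<subseteq> U" "V \<noteq> {}"
  obtains u where "u \<in> V" "u \<noteq> 0" "ennreal (norm (f u)) \<le> Linf_norm U f"
proof -
  have "AE u in lebesgue_on U. ennreal (norm (f u)) \<le> Linf_norm U f"
    unfolding Linf_norm_def by (rule esssup_AE)
  then have 1: "AE u in lebesgue. u \<in> U \<longrightarrow> ennreal (norm (f u)) \<le> Linf_norm U f"
    using U by (simp add: AE_restrict_space_iff)
  have 2: "AE u in lebesgue. u \<noteq> (0 :: real ^ 'n)"
    by (intro AE_completion AE_lborel_singleton)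
  from 1 2 have "AE u in lebesgue. u \<in> U \<longrightarrow> u \<noteq> 0 \<and> ennreal (norm (f u)) \<le> Linf_norm U f"
    by eventually_elim simp
  then obtain N where N: "N \<in> null_sets lebesgue"
    "{u. \<not> (u \<in> U \<longrightarrow> u \<noteq> 0 \<and> ennreal (norm (f u)) \<le> Linf_norm U f)} \<subseteq> N"
    unfolding eventually_ae_filter by auto
  have "\<not> V \<subseteq> N"
    using open_not_negligible[OF V(1,3)] N(1) negligible_subset negligible_iff_null_sets by blast
  then show ?thesis using N(2) V(2) that by blast
qed

section \<open>The characteristic function of the normalised sum\<close>

text \<open>Collects the data common to both conclusions. Each then becomes a statement about a
  sequence of times along which \<open>mean_square_matrix\<close> converges.\<close>

locale char_fun_decomposition = prob_space M for M :: "'a measure" +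
  fixes x :: "real \<Rightarrow> 'a \<Rightarrow> real ^ 'n"
    and U :: "(real ^ 'n) set"
    and c :: "real ^ 'n \<Rightarrow> complex"
    and ln_lam r :: "real \<Rightarrow> real ^ 'n \<Rightarrow> complex"
    and d :: "real \<Rightarrow> real ^ 'n \<Rightarrow> complex"
    and h :: "real \<Rightarrow> nat"
    and m :: "real \<Rightarrow> real \<Rightarrow> real"
    and A \<sigma> :: "real \<Rightarrow> real ^ 'n"
  assumes path: "path_integral_defined M x"
    and U: "0 \<in> interior U" "U \<in> sets lebesgue"
    and m_integrable: "\<And>T. T \<ge> 0 \<Longrightarrow> set_integrable lebesgue {1..real (h T)} (m T)"
    and m_variation: "\<exists>C. \<forall>\<^sub>F T in at_top. (LINT s:{1..real (h T)}|lebesgue. \<bar>m T s\<bar>) \<le> C * T"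
    and ln_integrable: "\<And>T t. T \<ge> 0 \<Longrightarrow> t \<in> U \<Longrightarrow> weighted_integrable h m T (\<lambda>s. ln_lam s t)"
    and A_integrable: "\<And>T. T \<ge> 0 \<Longrightarrow> weighted_integrable h m T A"
    and \<sigma>_integrable: "\<And>T. T \<ge> 0 \<Longrightarrow> weighted_integrable h m T (\<lambda>s. outer_square (\<sigma> s))"
    and char_fun: "\<And>T t. T \<ge> 0 \<Longrightarrow> t \<in> U \<Longrightarrow>
      (CLINT \<omega>|M. exp (\<i> * complex_of_real (t \<bullet> path_integral x T \<omega>)))
        = c t * exp (weighted_integral h m T (\<lambda>s. ln_lam s t)) + d T t"
    and ln_lam_branch: "\<forall>\<^sub>F t in at 0. \<forall>T\<ge>0. \<forall>s\<in>{1..real (h T)}.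
      ln_lam s t = quadratic_exponent (A s) (\<sigma> s) t + r s t"
    and remainder: "uniform_little_o_quadratic h r"
    and cont_c: "isCont c 0"
    and d_tendsto: "((\<lambda>T. Linf_norm U (d T)) \<longlongrightarrow> 0) at_top"
begin

abbreviation "law T \<equiv> distr M borel (normalised_sum x h m A T)"

lemma normalised_sum_measurable: "T \<ge> 0 \<Longrightarrow> normalised_sum x h m A T \<in> borel_measurable M"
  using path unfolding normalised_sum_def path_integral_defined_def
  by (intro borel_measurable_scaleR borel_measurable_diff borel_measurable_const) blast

lemma prob_space_law: "T \<ge> 0 \<Longrightarrow> prob_space (law T)"
  by (intro prob_space_distr normalised_sum_measurable)

text \<open>Centring multiplies the factorisation by a phase of modulus \<open>1\<close>: it cancels
  the linear term of the exponent and leaves the modulus of the \<open>d\<close> term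
  unchanged.\<close>

lemma vec_char_law:
  assumes "T > 0" and "t /\<^sub>R sqrt T \<in> U"
  shows "vec_char (law T) t = c (t /\<^sub>R sqrt T)
      * exp (weighted_integral h m T (\<lambda>s. ln_lam s (t /\<^sub>R sqrt T))
            - \<i> * complex_of_real ((t /\<^sub>R sqrt T) \<bullet> weighted_integral h m T A))
    + iexp (- ((t /\<^sub>R sqrt T) \<bullet> weighted_integral h m T A)) * d T (t /\<^sub>R sqrt T)"
proof -
  let ?u = "t /\<^sub>R sqrt T" and ?A = "weighted_integral h m T A"
  have "vec_char (law T) t = (CLINT \<omega>|M. iexp (t \<bullet> normalised_sum x h m A T \<omega>))"
    unfolding vec_char_def using assms normalised_sum_measurable[of T] by (subst integral_distr) simp_all
  also have "\<dots> = (CLINT \<omega>|M. iexp (- (?u \<bullet> ?A)) * iexp (?u \<bullet> path_integral x T \<omega>))"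
    unfolding exp_add[symmetric] normalised_sum_def
    by (simp add: inner_diff_right algebra_simps divide_inverse)
  also have "\<dots> = iexp (- (?u \<bullet> ?A)) * (c ?u * exp (weighted_integral h m T (\<lambda>s. ln_lam s ?u)) + d T ?u)"
    using char_fun[of T ?u] assms by simp
  also have "\<dots> = c ?u * exp (weighted_integral h m T (\<lambda>s. ln_lam s ?u) - \<i> * complex_of_real (?u \<bullet> ?A))
    + iexp (- (?u \<bullet> ?A)) * d T ?u"
    by (simp add: distrib_left exp_diff exp_minus field_simps)
  finally show ?thesis .
qed

text \<open>At \<open>t / sqrt T\<close> the remainder is at most
  \<open>\<epsilon> * (t \<bullet> t) / T\<close>, and the variation of the weights restores only a
  factor of order \<open>T\<close>. The argument \<open>t n\<close> varies with \<open>n\<close>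
  because the points of evaluation will be perturbed.\<close>

lemma exponent_tendsto:
  assumes T: "\<And>n. T n > 0" "filterlim T at_top sequentially"
    and S: "(\<lambda>n. mean_square_matrix h m \<sigma> (T n)) \<longlonglongrightarrow> S"
    and t: "t \<longlonglongrightarrow> t0" "\<And>n. t n \<noteq> 0"
    and U: "\<forall>\<^sub>F n in sequentially. t n /\<^sub>R sqrt (T n) \<in> U"
  shows "(\<lambda>n. weighted_integral h m (T n) (\<lambda>s. ln_lam s (t n /\<^sub>R sqrt (T n)))
            - \<i> * complex_of_real ((t n /\<^sub>R sqrt (T n)) \<bullet> weighted_integral h m (T n) A))
    \<longlonglongrightarrow> - complex_of_real ((t0 \<bullet> (S *v t0)) / 2)"
proof -
  define u where "u n = t n /\<^sub>R sqrt (T n)" for n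
  define w where "w n = weighted_integral h m (T n) (\<lambda>s. ln_lam s (u n))
    - \<i> * complex_of_real (u n \<bullet> weighted_integral h m (T n) A)" for n
  let ?q = "\<lambda>n. complex_of_real ((t n \<bullet> (mean_square_matrix h m \<sigma> (T n) *v t n)) / 2)"
  have "(\<lambda>n. inverse (sqrt (T n))) \<longlonglongrightarrow> 0"
    by (rule tendsto_inverse_0_at_top[OF filterlim_compose[OF sqrt_at_top T(2)]])
  then have "u \<longlonglongrightarrow> 0 *\<^sub>R t0" unfolding u_def by (intro tendsto_intros t)
  \<comment> \<open>Nonzero \<open>t n\<close> make \<open>u n\<close> approach \<open>0\<close>
    through nonzero points, as the filter \<open>at 0\<close> in the hypotheses on
    \<open>ln_lam\<close> and \<open>r\<close> demands.\<close>
  then have u_lim: "filterlim u (at 0) sequentially"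
    using t(2) less_imp_neq[OF T(1)] by (auto simp: filterlim_at u_def intro!: always_eventually)
  obtain C where C: "\<forall>\<^sub>F T in at_top. (LINT s:{1..real (h T)}|lebesgue. \<bar>m T s\<bar>) \<le> C * T"
    using m_variation by blast
  \<comment> \<open>The absolute value provides a nonnegative constant without an argument about the
    sign of \<open>C\<close>.\<close>
  have EC: "\<forall>\<^sub>F n in sequentially. (LINT s:{1..real (h (T n))}|lebesgue. \<bar>m (T n) s\<bar>) \<le> \<bar>C\<bar> * T n"
    using T(2)[unfolded filterlim_iff, rule_format, OF C]
    by eventually_elim (use less_imp_le[OF T(1)] in \<open>auto elim!: order_trans intro!: mult_right_mono\<close>)
  note EB = u_lim[unfolded filterlim_iff, rule_format, OF ln_lam_branch]
  obtain B where B: "B > 0" "\<And>n. norm (t n) \<le> B"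
    using convergent_imp_Bseq[OF convergentI[OF t(1)]] by (auto elim: BseqE)
  have bound: "\<forall>\<^sub>F n in sequentially. norm (w n + ?q n) \<le> \<epsilon> * (B\<^sup>2 * \<bar>C\<bar>)" if "\<epsilon> > 0" for \<epsilon>
  proof -
    have "\<forall>\<^sub>F t in at 0. \<forall>T\<ge>0. \<forall>s\<in>{1..real (h T)}. norm (r s t) \<le> \<epsilon> * (t \<bullet> t)"
      using remainder that unfolding uniform_little_o_quadratic_def by blast
    note ER = u_lim[unfolded filterlim_iff, rule_format, OF this]
    show ?thesis using EC EB ER U
    proof eventually_elim
      case (elim n)
      note Tn = less_imp_le[OF T(1)[of n]]
      let ?Q = "\<lambda>s. quadratic_exponent (A s) (\<sigma> s) (u n)"
      have uu: "u n \<bullet> u n = (t n \<bullet> t n) / T n"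
        using T(1)[of n] by (simp add: u_def real_sqrt_mult_self field_simps)
      have "norm (weighted_integral h m (T n) (\<lambda>s. ln_lam s (u n)) - weighted_integral h m (T n) ?Q)
        \<le> (\<epsilon> * (u n \<bullet> u n)) * (LINT s:{1..real (h (T n))}|lebesgue. \<bar>m (T n) s\<bar>)"
      proof (rule weighted_integral_near)
        show "set_integrable lebesgue {1..real (h (T n))} (m (T n))" by (rule m_integrable[OF Tn])
        show "weighted_integrable h m (T n) (\<lambda>s. ln_lam s (u n))"
          using ln_integrable[OF Tn] elim by (simp add: u_def)
        show "weighted_integrable h m (T n) ?Q"
          by (rule weighted_integrable_quadratic_exponent[OF A_integrable[OF Tn] \<sigma>_integrable[OF Tn]])
        show "norm (ln_lam s (u n) - ?Q s) \<le> \<epsilon> * (u n \<bullet> u n)" if "s \<in> {1..real (h (T n))}" for s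
          using elim(2,3) Tn that by simp
      qed
      also have "\<dots> \<le> (\<epsilon> * (u n \<bullet> u n)) * (\<bar>C\<bar> * T n)"
        using elim \<open>\<epsilon> > 0\<close> by (intro mult_left_mono) auto
      also have "\<dots> = \<epsilon> * ((t n \<bullet> t n) * \<bar>C\<bar>)"
        using T(1)[of n] by (simp add: uu)
      also have "\<dots> \<le> \<epsilon> * (B\<^sup>2 * \<bar>C\<bar>)"
        using B \<open>\<epsilon> > 0\<close> by (intro mult_left_mono mult_right_mono)
          (auto simp: power2_norm_eq_inner[symmetric] intro!: power_mono)
      also have "weighted_integral h m (T n) (\<lambda>s. ln_lam s (u n)) - weighted_integral h m (T n) ?Q = w n + ?q n"
      proof -
        have "(u n \<bullet> (weighted_integral h m (T n) (\<lambda>s. outer_square (\<sigma> s)) *v u n))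
          = t n \<bullet> (mean_square_matrix h m \<sigma> (T n) *v t n)"
          using T(1)[of n]
          by (simp add: u_def mean_square_matrix_def matrix_vector_mult_scaleR scaleR_matrix_vector_assoc[symmetric]
              real_sqrt_mult_self field_simps)
        then show ?thesis
          unfolding weighted_integral_quadratic_exponent[OF A_integrable[OF Tn] \<sigma>_integrable[OF Tn]]
          by (simp add: w_def)
      qed
      finally show ?case .
    qed
  qed
  have "(\<lambda>n. w n + ?q n) \<longlonglongrightarrow> 0"
  proof (rule tendstoI)
    fix e :: real assume e: "e > 0"
    \<comment> \<open>Adding \<open>1\<close> keeps the divisor positive when \<open>C\<close> is
      \<open>0\<close> and makes the resulting bound strictly smaller than \<open>e\<close>.\<close>
    let ?D = "B\<^sup>2 * \<bar>C\<bar> + 1"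
    have D: "?D > 0" by (simp add: add_nonneg_pos)
    have "e / ?D * (B\<^sup>2 * \<bar>C\<bar>) < e" using D e by (simp add: field_simps)
    with bound[of "e / ?D"] D e show "\<forall>\<^sub>F n in sequentially. dist (w n + ?q n) 0 < e"
      by (auto elim!: eventually_mono)
  qed
  moreover have "?q \<longlonglongrightarrow> complex_of_real ((t0 \<bullet> (S *v t0)) / 2)"
  proof -
    have "(\<lambda>n. mean_square_matrix h m \<sigma> (T n) *v t n) \<longlonglongrightarrow> S *v t0"
      unfolding matrix_vector_mult_def
      by (intro tendsto_vec_lambda tendsto_sum tendsto_mult tendsto_vec_nth S t)
    then show ?thesis by (intro tendsto_intros t) simp_all
  qed
  ultimately have "(\<lambda>n. (w n + ?q n) - ?q n) \<longlonglongrightarrow> 0 - complex_of_real ((t0 \<bullet> (S *v t0)) / 2)"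
    by (rule tendsto_diff)
  then show ?thesis by (simp add: w_def u_def)
qed

text \<open>The last conclusion is conditional so that a point exists for every \<open>T\<close>,
  even before \<open>t / sqrt T\<close> has entered \<open>U\<close>; a whole sequence of points can
  then be chosen at once.\<close>

lemma law_nearby_point:
  assumes "T > 0" "e > 0"
  obtains z where "z \<noteq> 0" "dist z t < e" "dist (vec_char (law T) z) (vec_char (law T) t) < e"
    "t /\<^sub>R sqrt T \<in> interior U \<Longrightarrow> z /\<^sub>R sqrt T \<in> U \<and>
      ennreal (norm (d T (z /\<^sub>R sqrt T))) \<le> Linf_norm U (d T)"
proof -
  have "isCont (vec_char (law T)) t"
    using assms by (intro isCont_vec_char prob_space_law) simp_all
  then obtain k where k: "k > 0" "\<And>z. dist z t < k \<Longrightarrow> dist (vec_char (law T) z) (vec_char (law T) t) < e"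
    using \<open>e > 0\<close> unfolding continuous_at_eps_delta by blast
  let ?k = "min k e"
  have k0: "?k > 0" using k \<open>e > 0\<close> by simp
  show ?thesis
  proof (cases "t /\<^sub>R sqrt T \<in> interior U")
    case True
    \<comment> \<open>Multiplying by \<open>sqrt T\<close> turns this radius back into
      \<open>?k\<close>.\<close>
    let ?V = "ball (t /\<^sub>R sqrt T) (?k / sqrt T) \<inter> interior U"
    have "t /\<^sub>R sqrt T \<in> ?V" using True k0 \<open>T > 0\<close> by simp
    then obtain u where u: "u \<in> ?V" "u \<noteq> 0" "ennreal (norm (d T u)) \<le> Linf_norm U (d T)"
      using Linf_norm_point[OF U(2), of ?V "d T"] interior_subset by blast
    have "sqrt T *\<^sub>R u - t = sqrt T *\<^sub>R (u - t /\<^sub>R sqrt T)"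
      using \<open>T > 0\<close> by (simp add: scaleR_diff_right)
    then have "dist (sqrt T *\<^sub>R u) t = sqrt T * dist u (t /\<^sub>R sqrt T)"
      using \<open>T > 0\<close> by (simp add: dist_norm)
    also have "\<dots> < ?k"
      using u(1) \<open>T > 0\<close> by (simp add: dist_commute field_simps)
    finally have "dist (sqrt T *\<^sub>R u) t < ?k" .
    then show ?thesis
      using u k(2) \<open>T > 0\<close> interior_subset by (intro that[of "sqrt T *\<^sub>R u"]) auto
  next
    case False
    \<comment> \<open>Only a nonzero point of the ball is wanted here; the essential bound is
      ignored.\<close>
    obtain z where z: "z \<in> ball t ?k" "z \<noteq> 0"
      using Linf_norm_point[of UNIV "ball t ?k"] k0 by auto
    then have "dist z t < ?k" by (simp add: dist_commute)
    then show ?thesis using z(2) False k(2) by (intro that[of z]) auto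
  qed
qed

text \<open>Perturbing \<open>t0\<close> with tolerance \<open>1 / Suc n\<close> changes neither the
  limit of the arguments nor that of the characteristic functions, so the limit can be computed at
  points where \<open>d\<close> is under control.\<close>

lemma vec_char_law_tendsto_c:
  assumes T: "\<And>n. T n > 0" "filterlim T at_top sequentially"
    and S: "(\<lambda>n. mean_square_matrix h m \<sigma> (T n)) \<longlonglongrightarrow> S"
  shows "(\<lambda>n. vec_char (law (T n)) t0) \<longlonglongrightarrow> c 0 * exp (- complex_of_real ((t0 \<bullet> (S *v t0)) / 2))"
proof -
  have "\<exists>z. z \<noteq> 0 \<and> dist z t0 < 1 / Suc n \<and> dist (vec_char (law (T n)) z) (vec_char (law (T n)) t0) < 1 / Suc n \<and>
    (t0 /\<^sub>R sqrt (T n) \<in> interior U \<longrightarrow> z /\<^sub>R sqrt (T n) \<in> U \<and>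
      ennreal (norm (d (T n) (z /\<^sub>R sqrt (T n)))) \<le> Linf_norm U (d (T n)))" for n
    by (rule law_nearby_point[OF T(1)[of n], of "1 / Suc n" t0]) auto
  then obtain t where t: "\<And>n. t n \<noteq> 0" "\<And>n. dist (t n) t0 < 1 / Suc n"
    "\<And>n. dist (vec_char (law (T n)) (t n)) (vec_char (law (T n)) t0) < 1 / Suc n"
    "\<And>n. t0 /\<^sub>R sqrt (T n) \<in> interior U \<Longrightarrow> t n /\<^sub>R sqrt (T n) \<in> U \<and>
      ennreal (norm (d (T n) (t n /\<^sub>R sqrt (T n)))) \<le> Linf_norm U (d (T n))"
    by metis
  note inv = LIMSEQ_Suc[OF lim_1_over_n[where 'a = real]]
  have t_lim: "t \<longlonglongrightarrow> t0"
    by (rule metric_tendsto_imp_tendsto[OF inv]) (use t(2) in \<open>auto simp: less_imp_le intro!: always_eventually\<close>)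
  have close: "(\<lambda>n. vec_char (law (T n)) (t n) - vec_char (law (T n)) t0) \<longlonglongrightarrow> 0"
    by (rule metric_tendsto_imp_tendsto[OF inv])
       (use t(3) in \<open>auto simp: less_imp_le dist_norm intro!: always_eventually\<close>)
  have s0: "(\<lambda>n. inverse (sqrt (T n))) \<longlonglongrightarrow> 0"
    by (rule tendsto_inverse_0_at_top[OF filterlim_compose[OF sqrt_at_top T(2)]])
  have "(\<lambda>n. t0 /\<^sub>R sqrt (T n)) \<longlonglongrightarrow> 0 *\<^sub>R t0" by (intro tendsto_intros s0)
  then have "\<forall>\<^sub>F n in sequentially. t0 /\<^sub>R sqrt (T n) \<in> interior U"
    using U(1) by (intro topological_tendstoD) auto
  then have good: "\<forall>\<^sub>F n in sequentially. t n /\<^sub>R sqrt (T n) \<in> U \<and>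
      ennreal (norm (d (T n) (t n /\<^sub>R sqrt (T n)))) \<le> Linf_norm U (d (T n))"
    by eventually_elim (rule t(4))
  then have inU: "\<forall>\<^sub>F n in sequentially. t n /\<^sub>R sqrt (T n) \<in> U"
    by eventually_elim blast
  have "(\<lambda>n. t n /\<^sub>R sqrt (T n)) \<longlonglongrightarrow> 0 *\<^sub>R t0" by (intro tendsto_intros s0 t_lim)
  then have c_lim: "(\<lambda>n. c (t n /\<^sub>R sqrt (T n))) \<longlonglongrightarrow> c 0"
    by (intro isCont_tendsto_compose[OF cont_c]) simp
  \<comment> \<open>\<open>Linf_norm\<close> may be infinite at early times, so the squeeze takes
    place in \<open>ennreal\<close> before returning to real norms.\<close>
  have "(\<lambda>n. ennreal (norm (d (T n) (t n /\<^sub>R sqrt (T n))))) \<longlonglongrightarrow> ennreal 0"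
  proof (rule tendsto_sandwich[where f = "\<lambda>_. ennreal 0" and h = "\<lambda>n. Linf_norm U (d (T n))"])
    show "(\<lambda>n. Linf_norm U (d (T n))) \<longlonglongrightarrow> ennreal 0"
      using filterlim_compose[OF d_tendsto T(2)] by simp
    show "\<forall>\<^sub>F n in sequentially. ennreal (norm (d (T n) (t n /\<^sub>R sqrt (T n)))) \<le> Linf_norm U (d (T n))"
      using good by eventually_elim blast
  qed simp_all
  then have d_lim: "(\<lambda>n. norm (d (T n) (t n /\<^sub>R sqrt (T n)))) \<longlonglongrightarrow> 0"
    by (rule tendsto_ennrealD) auto
  define e where "e n = iexp (- ((t n /\<^sub>R sqrt (T n)) \<bullet> weighted_integral h m (T n) A)) * d (T n) (t n /\<^sub>R sqrt (T n))" for n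
  have "(\<lambda>n. norm (e n)) \<longlonglongrightarrow> 0"
    using d_lim unfolding e_def norm_mult norm_exp_i_times by simp
  then have e_lim: "e \<longlonglongrightarrow> 0" by (rule tendsto_norm_zero_cancel)
  have "(\<lambda>n. c (t n /\<^sub>R sqrt (T n))
      * exp (weighted_integral h m (T n) (\<lambda>s. ln_lam s (t n /\<^sub>R sqrt (T n)))
            - \<i> * complex_of_real ((t n /\<^sub>R sqrt (T n)) \<bullet> weighted_integral h m (T n) A)) + e n)
    \<longlonglongrightarrow> c 0 * exp (- complex_of_real ((t0 \<bullet> (S *v t0)) / 2)) + 0"
    by (intro tendsto_add tendsto_mult tendsto_exp c_lim e_lim exponent_tendsto[OF T S t_lim t(1) inU])
  moreover have "\<forall>\<^sub>F n in sequentially. c (t n /\<^sub>R sqrt (T n))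
      * exp (weighted_integral h m (T n) (\<lambda>s. ln_lam s (t n /\<^sub>R sqrt (T n)))
            - \<i> * complex_of_real ((t n /\<^sub>R sqrt (T n)) \<bullet> weighted_integral h m (T n) A)) + e n
    = vec_char (law (T n)) (t n)"
    using inU by eventually_elim (simp only: vec_char_law[OF T(1)] e_def)
  ultimately have "(\<lambda>n. vec_char (law (T n)) (t n)) \<longlonglongrightarrow> c 0 * exp (- complex_of_real ((t0 \<bullet> (S *v t0)) / 2))"
    by (simp add: tendsto_cong)
  from tendsto_diff[OF this close] show ?thesis by simp
qed

text \<open>The value \<open>c 0 = 1\<close> has to come from the limit. In the factorisation at the
  point \<open>0\<close> itself, an essential supremum says nothing about \<open>d T 0\<close>, and
  the expansion of \<open>ln_lam\<close> is not asserted there.\<close>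

lemma vec_char_law_tendsto:
  assumes T: "\<And>n. T n > 0" "filterlim T at_top sequentially"
    and S: "(\<lambda>n. mean_square_matrix h m \<sigma> (T n)) \<longlonglongrightarrow> S"
  shows "(\<lambda>n. vec_char (law (T n)) t) \<longlonglongrightarrow> exp (- complex_of_real ((t \<bullet> (S *v t)) / 2))"
proof -
  have "(\<lambda>n. vec_char (law (T n)) 0) \<longlonglongrightarrow> 1"
    using vec_char_0[OF prob_space_law] T(1) by (simp add: less_imp_le)
  then have "c 0 = 1"
    using LIMSEQ_unique vec_char_law_tendsto_c[OF T S, of 0] by fastforce
  then show ?thesis using vec_char_law_tendsto_c[OF T S, of t] by simp
qed

lemma mean_square_limit_gaussian_exists:
  assumes T: "\<And>n. T n > 0" "filterlim T at_top sequentially"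
    and S: "(\<lambda>n. mean_square_matrix h m \<sigma> (T n)) \<longlonglongrightarrow> S"
  shows "\<exists>N. is_gaussian 0 S N"
proof (rule gaussian_exists)
  fix i j
  have sym: "mean_square_matrix h m \<sigma> T' $ i $ j = mean_square_matrix h m \<sigma> T' $ j $ i" if "T' > 0" for T'
  proof -
    have L: "bounded_linear (\<lambda>S :: real ^ 'n ^ 'n. S $ i $ j)" for i j
      by (rule bounded_linear_compose[OF bounded_linear_vec_nth bounded_linear_vec_nth])
    note entry = weighted_integral_bounded_linear[OF L \<sigma>_integrable[OF less_imp_le[OF that]], symmetric]
    have "(\<lambda>s. outer_square (\<sigma> s) $ i $ j) = (\<lambda>s. outer_square (\<sigma> s) $ j $ i)"
      by (simp add: outer_square_def mult.commute)
    then show ?thesis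
      unfolding mean_square_matrix_def vector_scaleR_component entry by simp
  qed
  have "(\<lambda>n. mean_square_matrix h m \<sigma> (T n) $ j $ i) \<longlonglongrightarrow> S $ j $ i"
    by (intro tendsto_vec_nth S)
  then show "S $ i $ j = S $ j $ i"
    using LIMSEQ_unique tendsto_vec_nth[OF tendsto_vec_nth[OF S, of i], of j] sym[OF T(1)] by simp
next
  fix z
  \<comment> \<open>The exponent is real, so a modulus of at most \<open>1\<close> is the same as a
    nonnegative quadratic form.\<close>
  have "norm (exp (- complex_of_real ((z \<bullet> (S *v z)) / 2))) \<le> 1"
    by (rule LIMSEQ_le_const2[OF tendsto_norm[OF vec_char_law_tendsto[OF T S]]])
       (blast intro: norm_vec_char_le prob_space_law less_imp_le T(1))
  then show "0 \<le> z \<bullet> (S *v z)" by simp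
qed

lemma normalised_sum_tendsto:
  assumes T: "\<And>n. T n > 0" "filterlim T at_top sequentially"
    and S: "(\<lambda>n. mean_square_matrix h m \<sigma> (T n)) \<longlonglongrightarrow> S"
    and N: "is_gaussian 0 S N"
  shows "converges_in_distribution M (\<lambda>n. normalised_sum x h m A (T n)) N sequentially"
  unfolding converges_in_distribution_def
proof (intro allI impI)
  fix f :: "real ^ 'n \<Rightarrow> real"
  assume f: "continuous_on UNIV f" "bounded (range f)"
  have T0: "T n \<ge> 0" for n using T(1)[of n] by simp
  have "(\<lambda>n. LINT y|law (T n). f y) \<longlonglongrightarrow> (LINT y|N. f y)"
    using vec_char_law_tendsto[OF T S] T0
    by (intro levy_continuity_vec prob_space_law f is_gaussian_prob_space[OF N] is_gaussian_sets[OF N])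
       (simp_all add: vec_char_gaussian[OF N])
  moreover have "(LINT y|law (T n). f y) = (LINT \<omega>|M. f (normalised_sum x h m A (T n) \<omega>))" for n
    by (intro integral_distr normalised_sum_measurable T0 borel_measurable_continuous_onI f)
  ultimately show "(\<lambda>n. LINT \<omega>|M. f (normalised_sum x h m A (T n) \<omega>)) \<longlonglongrightarrow> (LINT y|N. f y)"
    by simp
qed

end

section \<open>Convergence over all times, and along a subsequence of times\<close>

text \<open>The logarithm \<open>ln_lam\<close> is given as data, tied to \<open>lam\<close> by
  \<open>exp\<close> and pinned to its branch by the expansion at \<open>0\<close>. For nonnegative
  weights \<open>m_variation\<close> holds with \<open>C = 1\<close>, since they integrate to
  \<open>T\<close>; for signed weights it is a genuine restriction.\<close>

theorem theorem3p3:
  fixes M :: "'a measure"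
    and x :: "real \<Rightarrow> 'a \<Rightarrow> real ^ 'n"
    and U :: "(real ^ 'n) set"
    and c :: "real ^ 'n \<Rightarrow> complex"
    and lam ln_lam r :: "real \<Rightarrow> real ^ 'n \<Rightarrow> complex"
    and d :: "real \<Rightarrow> real ^ 'n \<Rightarrow> complex"
    and h :: "real \<Rightarrow> nat"
    and m :: "real \<Rightarrow> real \<Rightarrow> real"
    and A \<sigma> :: "real \<Rightarrow> real ^ 'n"
  assumes "prob_space M"
    and "L2_process M x"
    and "path_integral_defined M x"
    and "0 \<in> interior U" and "U \<in> sets lebesgue"
    and h_pos: "\<And>T. T \<ge> 0 \<Longrightarrow> h T \<ge> 1"
    and m_integrable: "\<And>T. T \<ge> 0 \<Longrightarrow> set_integrable lebesgue {1..real (h T)} (m T)"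
    and m_total: "\<And>T. T \<ge> 0 \<Longrightarrow> (LINT s:{1..real (h T)}|lebesgue. m T s) = T"
    and m_variation: "\<exists>C. \<forall>\<^sub>F T in at_top. (LINT s:{1..real (h T)}|lebesgue. \<bar>m T s\<bar>) \<le> C * T"
    and ln_integrable: "\<And>T t. T \<ge> 0 \<Longrightarrow> t \<in> U \<Longrightarrow> weighted_integrable h m T (\<lambda>s. ln_lam s t)"
    and A_integrable: "\<And>T. T \<ge> 0 \<Longrightarrow> weighted_integrable h m T A"
    and \<sigma>_integrable: "\<And>T. T \<ge> 0 \<Longrightarrow> weighted_integrable h m T (\<lambda>s. outer_square (\<sigma> s))"
    and char_fun: "\<And>T t. T \<ge> 0 \<Longrightarrow> t \<in> U \<Longrightarrow>
      (CLINT \<omega>|M. exp (\<i> * complex_of_real (t \<bullet> path_integral x T \<omega>)))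
        = c t * exp (weighted_integral h m T (\<lambda>s. ln_lam s t)) + d T t"
    and ln_lam_log: "\<And>T s t. T \<ge> 0 \<Longrightarrow> s \<in> {1..real (h T)} \<Longrightarrow> t \<in> U \<Longrightarrow>
      exp (ln_lam s t) = lam s t"
    and ln_lam_branch: "\<forall>\<^sub>F t in at 0. \<forall>T\<ge>0. \<forall>s\<in>{1..real (h T)}.
      ln_lam s t = quadratic_exponent (A s) (\<sigma> s) t + r s t"
    and i: "\<forall>\<^sub>F t in at 0. \<forall>T\<ge>0. \<forall>s\<in>{1..real (h T)}.
      lam s t = exp (quadratic_exponent (A s) (\<sigma> s) t + r s t)"
    and i_remainder: "uniform_little_o_quadratic h r"
    and ii: "isCont c 0"
    and iii: "((\<lambda>T. Linf_norm U (d T)) \<longlongrightarrow> 0) at_top"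
  shows
    "(\<forall>\<mu>2 :: real ^ 'n ^ 'n.
        (\<forall>i j. ((\<lambda>T. mean_square_matrix h m \<sigma> T $ i $ j) \<longlongrightarrow> \<mu>2 $ i $ j) at_top \<and> 0 \<le> \<mu>2 $ i $ j)
        \<longrightarrow> (\<exists>N. is_gaussian 0 \<mu>2 N \<and>
              converges_in_distribution M (normalised_sum x h m A) N at_top))
     \<and>
     (\<forall>\<eta>2 :: real ^ 'n ^ 'n.
        (\<forall>i j. 0 \<le> \<eta>2 $ i $ j \<and> (\<forall>T>0. \<bar>mean_square_matrix h m \<sigma> T $ i $ j\<bar> \<le> \<eta>2 $ i $ j))
        \<longrightarrow> (\<exists>(\<zeta>2 :: real ^ 'n ^ 'n) (Tj :: nat \<Rightarrow> real) N.
              (\<forall>j. 0 < Tj j) \<and> filterlim Tj at_top sequentially \<and>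
              (\<forall>i j. \<bar>\<zeta>2 $ i $ j\<bar> \<le> \<eta>2 $ i $ j) \<and>
              is_gaussian 0 \<zeta>2 N \<and>
              converges_in_distribution M (\<lambda>j. normalised_sum x h m A (Tj j)) N sequentially))"
proof -
  interpret char_fun_decomposition M x U c ln_lam r d h m A \<sigma>
    using assms by (intro char_fun_decomposition.intro char_fun_decomposition_axioms.intro) assumption+
  have a: "\<exists>N. is_gaussian 0 \<mu>2 N \<and> converges_in_distribution M (normalised_sum x h m A) N at_top"
    if \<mu>: "\<forall>i j. ((\<lambda>T. mean_square_matrix h m \<sigma> T $ i $ j) \<longlongrightarrow> \<mu>2 $ i $ j) at_top" for \<mu>2 :: "real ^ 'n ^ 'n"
  proof -
    have S: "(mean_square_matrix h m \<sigma> \<longlongrightarrow> \<mu>2) at_top"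
      using \<mu> by (intro vec_tendstoI) blast
    have T0: "filterlim (\<lambda>n. real (Suc n)) at_top sequentially"
      by (intro filterlim_compose[OF filterlim_real_sequentially filterlim_Suc])
    \<comment> \<open>One particular sequence of times suffices to see that the limit matrix is a
      covariance; the resulting \<open>N\<close> then serves every sequence.\<close>
    obtain N where N: "is_gaussian 0 \<mu>2 N"
      using mean_square_limit_gaussian_exists[OF _ T0 filterlim_compose[OF S T0]] by auto
    have "converges_in_distribution M (normalised_sum x h m A) N at_top"
      unfolding converges_in_distribution_def
    proof (intro allI impI tendsto_at_topI_sequentially)
      fix f :: "real ^ 'n \<Rightarrow> real" and T :: "nat \<Rightarrow> real"
      assume f: "continuous_on UNIV f" "bounded (range f)" and T: "filterlim T at_top sequentially"
      \<comment> \<open>An arbitrary sequence tending to infinity may start with nonpositive times.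
        Truncation makes all of them positive and changes only finitely many.\<close>
      let ?T = "\<lambda>n. max 1 (T n)"
      have eq: "\<forall>\<^sub>F n in sequentially. ?T n = T n"
        using T[unfolded filterlim_at_top, rule_format, of 1] by eventually_elim simp
      have T': "filterlim ?T at_top sequentially"
        using T filterlim_cong[OF refl refl eq] by blast
      have "converges_in_distribution M (\<lambda>n. normalised_sum x h m A (?T n)) N sequentially"
        using normalised_sum_tendsto[OF _ T' filterlim_compose[OF S T'] N] by auto
      then have "(\<lambda>n. LINT \<omega>|M. f (normalised_sum x h m A (?T n) \<omega>)) \<longlonglongrightarrow> (LINT y|N. f y)"
        using f unfolding converges_in_distribution_def by blast
      then show "(\<lambda>n. LINT \<omega>|M. f (normalised_sum x h m A (T n) \<omega>)) \<longlonglongrightarrow> (LINT y|N. f y)"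
        by (rule Lim_transform_eventually) (use eq in eventually_elim, simp)
    qed
    with N show ?thesis by blast
  qed
  have b: "\<exists>(\<zeta>2 :: real ^ 'n ^ 'n) (Tj :: nat \<Rightarrow> real) N.
      (\<forall>j. 0 < Tj j) \<and> filterlim Tj at_top sequentially \<and>
      (\<forall>i j. \<bar>\<zeta>2 $ i $ j\<bar> \<le> \<eta>2 $ i $ j) \<and> is_gaussian 0 \<zeta>2 N \<and>
      converges_in_distribution M (\<lambda>j. normalised_sum x h m A (Tj j)) N sequentially"
    if \<eta>: "\<And>T i j. T > 0 \<Longrightarrow> \<bar>mean_square_matrix h m \<sigma> T $ i $ j\<bar> \<le> \<eta>2 $ i $ j" for \<eta>2 :: "real ^ 'n ^ 'n"
  proof -
    let ?V = "\<lambda>n. mean_square_matrix h m \<sigma> (real (Suc n))"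
    have "norm (?V n) \<le> (\<Sum>i\<in>UNIV. \<Sum>j\<in>UNIV. \<eta>2 $ i $ j)" for n
    proof -
      have "norm (?V n) \<le> (\<Sum>i\<in>UNIV. norm (?V n $ i))"
        by (simp add: norm_vec_def L2_set_le_sum)
      also have "\<dots> \<le> (\<Sum>i\<in>UNIV. \<Sum>j\<in>UNIV. \<bar>?V n $ i $ j\<bar>)"
        by (intro sum_mono norm_le_l1_cart)
      also have "\<dots> \<le> (\<Sum>i\<in>UNIV. \<Sum>j\<in>UNIV. \<eta>2 $ i $ j)"
        by (intro sum_mono \<eta>) simp
      finally show ?thesis .
    qed
    \<comment> \<open>Matrices form a finite-dimensional space, so the entrywise bound yields a
      convergent subsequence, and the bound survives in its limit. The times \<open>Suc n\<close>
      are positive, as the bound requires.\<close>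
    then have "bounded (range ?V)" unfolding bounded_iff by blast
    then obtain \<zeta>2 k where k: "strict_mono (k :: nat \<Rightarrow> nat)" and \<zeta>: "(?V \<circ> k) \<longlonglongrightarrow> \<zeta>2"
      using bounded_imp_convergent_subsequence by blast
    define Tj where "Tj n = real (Suc (k n))" for n
    have T0: "Tj n > 0" for n by (simp add: Tj_def)
    have T: "filterlim Tj at_top sequentially"
      unfolding Tj_def using filterlim_subseq[OF k]
      by (intro filterlim_compose[OF filterlim_real_sequentially filterlim_compose[OF filterlim_Suc]])
    have S: "(\<lambda>n. mean_square_matrix h m \<sigma> (Tj n)) \<longlonglongrightarrow> \<zeta>2"
      using \<zeta> by (simp add: Tj_def comp_def)
    obtain N where N: "is_gaussian 0 \<zeta>2 N"
      using mean_square_limit_gaussian_exists[OF T0 T S] by blast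
    have "\<bar>\<zeta>2 $ i $ j\<bar> \<le> \<eta>2 $ i $ j" for i j
      by (rule LIMSEQ_le_const2[OF tendsto_rabs[OF tendsto_vec_nth[OF tendsto_vec_nth[OF S]]]])
         (use \<eta>[OF T0] in blast)
    with N T0 T normalised_sum_tendsto[OF T0 T S N] show ?thesis by blast
  qed
  show ?thesis using a b by blast
qed

end
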